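(* Let $d\ge 1$ and let $b$ belong to the closed unit ball of the multiplier algebra $\mathcal{M}(H^2_d)$ of the Drury-Arveson space. If $b$ is quasi-extreme, then $b$ is an extreme point of the closed unit ball of $\mathcal{M}(H^2_d)$.
   Context: $\mathbb{B}^d$ is the open unit ball of $\mathbb{C}^d$; for $z,w\in\mathbb{C}^d$ write $zw^*=\sum_{j=1}^d z_j\overline{w_j}$; for a scalar, $*$ means complex conjugation. The Drury-Arveson space $H^2_d$ is the reproducing kernel Hilbert space of holomorphic functions on $\mathbb{B}^d$ with kernel $k(z,w)=\frac{1}{1-zw^*}$. A multiplier is a holomorphic function $b$ on $\mathbb{B}^d$ with $bf\in H^2_d$ for all $f\in H^2_d$; then $M_b:f\mapsto bf$ is a bounded operator on $H^2_d$. $\mathcal{M}(H^2_d)$ is the Banach algebra of multipliers with norm $\|M_b\|$. The multiplier $b$ is contractive if $\|M_b\|\le 1$. For a contractive multiplier $b$, $\mathcal{H}(b)$ is the reproducing kernel Hilbert space on $\mathbb{B}^d$ with kernel $k^b(z,w)=\frac{1-b(z)b(w)^*}{1-zw^*}$, and its norm is $\|\cdot\|_b$. A tuple $(b_1,\dots,b_d)$ of functions in $\mathcal{H}(b)$ is called admissible if (i) $\sum_{j=1}^d z_jb_j(z)=b(z)-b(0)$ for all $z\in\mathbb{B}^d$, and (ii) $\sum_{j=1}^d\|b_j\|_b^2\le 1-|b(0)|^2$. The contractive multiplier $b$ is quasi-extreme if every admissible tuple satisfies the equality $\sum_{j=1}^d\|b_j\|_b^2=1-|b(0)|^2$; equivalently,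 $b$ is not quasi-extreme if and only if there is an admissible tuple with $\sum_{j=1}^d\|b_j\|_b^2<1-|b(0)|^2$. *)

theory Defs
  imports "HOL-Analysis.Analysis" "HOL-Library.Function_Algebras"
begin

section \<open>Functions as a real vector space\<close>

instantiation "fun" :: (type, real_vector) real_vector
begin

definition "scaleR_fun r f = (\<lambda>x. r *\<^sub>R f x)"

instance
  by standard (auto simp: scaleR_fun_def plus_fun_def fun_eq_iff scaleR_add_right scaleR_add_left)

end

section \<open>Reproducing kernel Hilbert spaces\<close>

text \<open>
  \<open>H\<close> is a complex Hilbert space of functions with reproducing kernel \<open>K\<close>. Its inner product \<open>ip\<close>,
  linear in the first argument, is relevant on \<open>H\<close> only.
\<close>

locale rkhs =
  fixes K :: "'x \<Rightarrow> 'x \<Rightarrow> complex"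
    and H :: "('x \<Rightarrow> complex) set"
    and ip :: "('x \<Rightarrow> complex) \<Rightarrow> ('x \<Rightarrow> complex) \<Rightarrow> complex"
  assumes zero_mem: "0 \<in> H"
    and add_mem: "\<And>f g. f \<in> H \<Longrightarrow> g \<in> H \<Longrightarrow> f + g \<in> H"
    and scale_mem: "\<And>c f. f \<in> H \<Longrightarrow> (\<lambda>x. c * f x) \<in> H"
    and ip_add: "\<And>f g h. f \<in> H \<Longrightarrow> g \<in> H \<Longrightarrow> h \<in> H \<Longrightarrow> ip (f + g) h = ip f h + ip g h"
    and ip_scale: "\<And>c f g. f \<in> H \<Longrightarrow> g \<in> H \<Longrightarrow> ip (\<lambda>x. c * f x) g = c * ip f g"
    and ip_commute: "\<And>f g. f \<in> H \<Longrightarrow> g \<in> H \<Longrightarrow> ip g f = cnj (ip f g)"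
    and ip_nonneg: "\<And>f. f \<in> H \<Longrightarrow> 0 \<le> Re (ip f f)"
    and ip_definite: "\<And>f. f \<in> H \<Longrightarrow> ip f f = 0 \<Longrightarrow> f = 0"
    and complete: "\<And>s :: nat \<Rightarrow> 'x \<Rightarrow> complex.
        (\<And>n. s n \<in> H) \<Longrightarrow>
        (\<forall>e>0. \<exists>N. \<forall>m\<ge>N. \<forall>n\<ge>N. sqrt (Re (ip (s m - s n) (s m - s n))) < e) \<Longrightarrow>
        \<exists>f\<in>H. (\<lambda>n. sqrt (Re (ip (s n - f) (s n - f)))) \<longlonglongrightarrow> 0"
    and kernel_mem: "\<And>w. (\<lambda>z. K z w) \<in> H"
    and reproducing: "\<And>f w. f \<in> H \<Longrightarrow> ip f (\<lambda>z. K z w) = f w"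

text \<open>
  By the Moore--Aronszajn theorem, a positive semidefinite kernel has exactly one reproducing kernel
  Hilbert space. The choice operator is used instead of a definite description because the values
  of the inner product outside the space are not determined.
\<close>

definition rkhs_of ::
  "('x \<Rightarrow> 'x \<Rightarrow> complex) \<Rightarrow>
    ('x \<Rightarrow> complex) set \<times> (('x \<Rightarrow> complex) \<Rightarrow> ('x \<Rightarrow> complex) \<Rightarrow> complex)"
  where "rkhs_of K = (SOME (H, ip). rkhs K H ip)"

definition rkhs_space :: "('x \<Rightarrow> 'x \<Rightarrow> complex) \<Rightarrow> ('x \<Rightarrow> complex) set"
  where "rkhs_space K = fst (rkhs_of K)"

definition rkhs_norm :: "('x \<Rightarrow> 'x \<Rightarrow> complex) \<Rightarrow> ('x \<Rightarrow> complex) \<Rightarrow> real"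
  where "rkhs_norm K f = sqrt (Re (snd (rkhs_of K) f f))"

section \<open>The Drury--Arveson space and its multipliers\<close>

text \<open>
  The open unit ball of \<open>d\<close>-dimensional complex space, with \<open>d = CARD('n)\<close>. It is made a type so that
  functions on the ball are equal precisely when they agree on the ball.
\<close>

typedef 'n unit_ball = "ball 0 1 :: (complex ^ 'n::finite) set"
  morphisms vec_of pt_of
  by (metis centre_in_ball zero_less_one)

definition herm :: "'n::finite unit_ball \<Rightarrow> 'n unit_ball \<Rightarrow> complex"
  where "herm z w = (\<Sum>j\<in>UNIV. vec_of z $ j * cnj (vec_of w $ j))"

definition origin :: "'n::finite unit_ball"
  where "origin = pt_of 0"

definition holomorphic_ball :: "('n::finite unit_ball \<Rightarrow> complex) \<Rightarrow> bool"
  where "holomorphic_ball f \<longleftrightarrow>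
    (\<forall>z\<in>ball 0 1. \<exists>D :: complex ^ 'n.
      ((\<lambda>v. f (pt_of v)) has_derivative (\<lambda>h. \<Sum>j\<in>UNIV. D $ j * h $ j)) (at z))"

definition da_kernel :: "'n::finite unit_ball \<Rightarrow> 'n unit_ball \<Rightarrow> complex"
  where "da_kernel z w = 1 / (1 - herm z w)"

text \<open>
  Holomorphy of the elements of the Drury--Arveson space is not demanded separately: it follows from
  the form of the kernel.
\<close>

abbreviation drury_arveson :: "('n::finite unit_ball \<Rightarrow> complex) set"
  where "drury_arveson \<equiv> rkhs_space da_kernel"

abbreviation da_norm :: "('n::finite unit_ball \<Rightarrow> complex) \<Rightarrow> real"
  where "da_norm \<equiv> rkhs_norm da_kernel"

definition multipliers :: "('n::finite unit_ball \<Rightarrow> complex) set"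
  where "multipliers = {b. holomorphic_ball b \<and> (\<forall>f\<in>drury_arveson. b * f \<in> drury_arveson)}"

text \<open>
  The operator norm of \<open>f \<mapsto> b * f\<close>. It takes values in \<open>[0, \<infinity>]\<close> so that the definition does
  not depend on the (automatic) boundedness of this operator.
\<close>

definition multiplier_norm :: "('n::finite unit_ball \<Rightarrow> complex) \<Rightarrow> ennreal"
  where "multiplier_norm b =
    (SUP f \<in> {f \<in> drury_arveson. da_norm f \<le> 1}. ennreal (da_norm (b * f)))"

definition multiplier_unit_ball :: "('n::finite unit_ball \<Rightarrow> complex) set"
  where "multiplier_unit_ball = {b \<in> multipliers. multiplier_norm b \<le> 1}"

section \<open>Quasi-extreme multipliers\<close>

definition dbr_kernel ::
  "('n::finite unit_ball \<Rightarrow> complex) \<Rightarrow> 'n unit_ball \<Rightarrow> 'n unit_ball \<Rightarrow> complex"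
  where "dbr_kernel b z w = (1 - b z * cnj (b w)) / (1 - herm z w)"

definition admissible ::
  "('n::finite unit_ball \<Rightarrow> complex) \<Rightarrow> ('n \<Rightarrow> 'n unit_ball \<Rightarrow> complex) \<Rightarrow> bool"
  where "admissible b bs \<longleftrightarrow>
    (\<forall>j. bs j \<in> rkhs_space (dbr_kernel b)) \<and>
    (\<forall>z. (\<Sum>j\<in>UNIV. vec_of z $ j * bs j z) = b z - b origin) \<and>
    (\<Sum>j\<in>UNIV. (rkhs_norm (dbr_kernel b) (bs j))\<^sup>2) \<le> 1 - (cmod (b origin))\<^sup>2"

text \<open>Only meaningful for \<open>b\<close> in the closed unit ball, where \<open>dbr_kernel b\<close> is positive semidefinite.\<close>

definition quasi_extreme :: "('n::finite unit_ball \<Rightarrow> complex) \<Rightarrow> bool"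
  where "quasi_extreme b \<longleftrightarrow>
    (\<forall>bs. admissible b bs \<longrightarrow>
      (\<Sum>j\<in>UNIV. (rkhs_norm (dbr_kernel b) (bs j))\<^sup>2) = 1 - (cmod (b origin))\<^sup>2)"

end

theory Submission
  imports Defs
begin

text \<open>
  If \<open>b\<close> lies strictly between two distinct contractive multipliers \<open>a\<close> and \<open>c\<close>, then the parallelogram
  law gives \<open>\<parallel>b G\<parallel>\<^sup>2 + \<delta> \<parallel>f G\<parallel>\<^sup>2 \<le> \<parallel>G\<parallel>\<^sup>2\<close> on the Drury--Arveson space, with \<open>f = a - c\<close> and some \<open>\<delta> > 0\<close>.
  At a point \<open>l\<close> with \<open>f(l) \<noteq> 0\<close> this bounds evaluation at \<open>l\<close> by the defect of \<open>M\<^sub>b\<close>, which means that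
  \<open>h(z) = b(z) / (1 - z l\<^sup>*)\<close> belongs to \<open>H(b)\<close>.

  The kernel \<open>k\<^sup>b(z, w) + b(z) b(w)\<^sup>* = z w\<^sup>* k\<^sup>b(z, w) + 1\<close> describes one Hilbert space in two ways: as the
  functions \<open>g + c b\<close> and as the functions \<open>\<Sum>\<^sub>j z\<^sub>j g\<^sub>j + \<gamma>\<close>, with \<open>g\<close> and all \<open>g\<^sub>j\<close> in \<open>H(b)\<close>, normed by the
  cheapest representation. The function \<open>h - b = z l\<^sup>* h\<close> has a representation of the second kind whose
  squared norm is at most \<open>\<parallel>h\<parallel>\<^sup>2\<close>. Were \<open>b\<close> not in \<open>H(b)\<close>, its only representation of the first kind would be
  \<open>(h, -1)\<close>, which costs \<open>\<parallel>h\<parallel>\<^sup>2 + 1\<close>. So \<open>b\<close> belongs to \<open>H(b)\<close>. Then \<open>b = \<epsilon> b + (1 - \<epsilon>) b\<close> costs less than \<open>1\<close>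
  for small \<open>\<epsilon>\<close>, and the corresponding representation of the second kind is an admissible tuple with
  strict inequality.
\<close>

section \<open>Finite linear combinations\<close>

text \<open>
  A combination is a list of coefficients and points. The functional \<open>pairing F\<close> conjugates the
  coefficients, so that \<open>pairing f a\<close> is the inner product of \<open>f\<close> with the combination \<open>a\<close> of kernel functions.
\<close>

definition comb :: "('x \<Rightarrow> 'y \<Rightarrow> complex) \<Rightarrow> (complex \<times> 'x) list \<Rightarrow> 'y \<Rightarrow> complex"
  where "comb \<phi> a = (\<lambda>y. \<Sum>(c, x)\<leftarrow>a. c * \<phi> x y)"

definition pairing :: "('x \<Rightarrow> complex) \<Rightarrow> (complex \<times> 'x) list \<Rightarrow> complex"
  where "pairing F a = (\<Sum>(c, x)\<leftarrow>a. cnj c * F x)"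

definition weight :: "('x \<Rightarrow> complex) \<Rightarrow> (complex \<times> 'x) list \<Rightarrow> (complex \<times> 'x) list"
  where "weight g a = map (\<lambda>(c, x). (g x * c, x)) a"

lemma comb_Nil [simp]: "comb \<phi> [] = (\<lambda>_. 0)"
  by (simp add: comb_def)

lemma comb_Cons: "comb \<phi> ((c, x) # a) = (\<lambda>y. c * \<phi> x y) + comb \<phi> a"
  by (simp add: comb_def fun_eq_iff)

lemma comb_append: "comb \<phi> (a @ b) = comb \<phi> a + comb \<phi> b"
  by (simp add: comb_def fun_eq_iff)

lemma comb_weight: "comb \<phi> (weight g a) = comb (\<lambda>x y. g x * \<phi> x y) a"
  by (simp add: comb_def weight_def fun_eq_iff case_prod_unfold comp_def mult.assoc mult.left_commute)

lemma comb_weight_const: "comb \<phi> (weight (\<lambda>_. t) a) = (\<lambda>y. t * comb \<phi> a y)"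
  by (induction a) (auto simp: comb_def weight_def fun_eq_iff algebra_simps)

lemma pairing_Nil [simp]: "pairing F [] = 0"
  by (simp add: pairing_def)

lemma pairing_Cons [simp]: "pairing F ((c, x) # a) = cnj c * F x + pairing F a"
  by (simp add: pairing_def)

lemma pairing_append: "pairing F (a @ b) = pairing F a + pairing F b"
  by (simp add: pairing_def)

lemma pairing_weight: "pairing F (weight g a) = pairing (\<lambda>x. cnj (g x) * F x) a"
  by (induction a) (auto simp: pairing_def weight_def)

lemma pairing_cmult: "pairing (\<lambda>x. t * F x) a = t * pairing F a"
  by (induction a) (auto simp: algebra_simps)

lemma pairing_weight_const: "pairing F (weight (\<lambda>_. t) a) = cnj t * pairing F a"
  by (simp add: pairing_weight pairing_cmult)

lemma pairing_add: "pairing (F + G) a = pairing F a + pairing G a"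
  by (induction a) (auto simp: algebra_simps)

lemma pairing_diff: "pairing (F - G) a = pairing F a - pairing G a"
  by (induction a) (auto simp: algebra_simps)

lemma pairing_zero [simp]: "pairing 0 a = 0" "pairing (\<lambda>_. 0) a = 0"
  by (induction a) auto

text \<open>Interchange of two finite sums. The outer conjugations appear because
  \<open>pairing\<close> conjugates coefficients while \<open>comb\<close> does not.\<close>

lemma pairing_comb: "pairing (comb \<phi> a) b = cnj (pairing (\<lambda>x. cnj (pairing (\<phi> x) b)) a)"
proof (induction a)
  case (Cons p a)
  show ?case
    by (cases p) (simp only: comb_Cons pairing_add pairing_cmult Cons pairing_Cons
        complex_cnj_add complex_cnj_mult complex_cnj_cnj)
qed (simp add: pairing_zero)

lemma tendsto_pairing:
  assumes "\<And>x. (\<lambda>n. F n x) \<longlonglongrightarrow> G x"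
  shows "(\<lambda>n. pairing (F n) a) \<longlonglongrightarrow> pairing G a"
  by (induction a) (auto intro!: tendsto_intros assms)

lemma tendsto_comb:
  assumes "\<And>x. (\<lambda>n. \<phi> n x y) \<longlonglongrightarrow> \<psi> x y"
  shows "(\<lambda>n. comb (\<phi> n) a y) \<longlonglongrightarrow> comb \<psi> a y"
  by (induction a) (auto simp: comb_Cons intro!: tendsto_intros assms)

text \<open>Arithmetic core of Cauchy-Schwarz for a form that may be degenerate. With q = |<f, g>|^2
  the quadratic in s is the squared norm of f - s <f, g> g. If B > 0, its minimum at s = 1 / B gives
  the claim; if B = 0, it is linear in s and can stay nonnegative only for q = 0.\<close>

lemma discriminant_bound:
  fixes A B q :: real
  assumes "\<And>s. 0 \<le> A - 2 * s * q + s\<^sup>2 * q * B" "0 \<le> A" "0 \<le> B" "0 \<le> q"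
  shows "q \<le> A * B"
proof (cases "B = 0")
  case True
  have "q = 0"
  proof (rule ccontr)
    assume "q \<noteq> 0"
    then show False
      using assms(1)[of "(A + 1) / q"] True \<open>0 \<le> A\<close> by simp
  qed
  then show ?thesis
    using assms by simp
next
  case False
  then have B: "B > 0"
    using assms by simp
  have "0 \<le> A - 2 * (1 / B) * q + (1 / B)\<^sup>2 * q * B"
    by (rule assms)
  also have "\<dots> = A - q / B"
    using B by (simp add: field_simps power2_eq_square)
  finally show ?thesis
    using B by (simp add: field_simps)
qed

lemma self_mult_le_imp_le:
  fixes x C :: real
  assumes "x * x \<le> C * x" "0 \<le> C"
  shows "x \<le> C"
proof (rule ccontr)
  assume "\<not> x \<le> C"
  then have "C * x < x * x"
    using \<open>0 \<le> C\<close> by (intro mult_strict_right_mono) auto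
  then show False
    using assms by simp
qed

section \<open>The Moore--Aronszajn theorem\<close>

definition section_at :: "('x \<Rightarrow> 'x \<Rightarrow> complex) \<Rightarrow> 'x \<Rightarrow> 'x \<Rightarrow> complex"
  where "section_at K w = (\<lambda>z. K z w)"

definition gram :: "('x \<Rightarrow> 'x \<Rightarrow> complex) \<Rightarrow> (complex \<times> 'x) list \<Rightarrow> (complex \<times> 'x) list \<Rightarrow> complex"
  where "gram K a b = pairing (comb (section_at K) a) b"

locale psd_kernel =
  fixes K :: "'x \<Rightarrow> 'x \<Rightarrow> complex"
  assumes kernel_cnj: "K w z = cnj (K z w)"
    and psd: "0 \<le> Re (gram K a a)"
begin

lemma gram_cnj: "gram K b a = cnj (gram K a b)"
proof -
  have "pairing (section_at K x) b = cnj (comb (section_at K) b x)" for x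
    by (induction b) (auto simp: comb_Cons section_at_def kernel_cnj[of _ x])
  then show ?thesis
    by (simp add: gram_def pairing_comb[of _ a])
qed

lemma gram_append_left: "gram K (a @ b) c = gram K a c + gram K b c"
  by (simp add: gram_def comb_append pairing_add)

lemma gram_append_right: "gram K c (a @ b) = gram K c a + gram K c b"
  by (simp add: gram_def pairing_append)

lemma gram_scale_left: "gram K (weight (\<lambda>_. t) a) b = t * gram K a b"
  by (simp add: gram_def comb_weight_const pairing_cmult)

lemma gram_scale_right: "gram K a (weight (\<lambda>_. t) b) = cnj t * gram K a b"
  by (simp add: gram_def pairing_weight_const)

section \<open>The seminorm of a combination and its dual norm\<close>

definition knorm :: "(complex \<times> 'x) list \<Rightarrow> real"
  where "knorm a = sqrt (Re (gram K a a))"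

lemma knorm_nonneg [simp]: "0 \<le> knorm a"
  by (simp add: knorm_def psd)

lemma knorm_sq: "(knorm a)\<^sup>2 = Re (gram K a a)"
  by (simp add: knorm_def psd)

lemma gram_cauchy_schwarz: "cmod (gram K a b) \<le> knorm a * knorm b"
proof -
  let ?q = "(cmod (gram K a b))\<^sup>2"
  have "0 \<le> Re (gram K a a) - 2 * s * ?q + s\<^sup>2 * ?q * Re (gram K b b)" for s
  proof -
    let ?t = "- of_real s * gram K a b"
    let ?e = "a @ weight (\<lambda>_. ?t) b"
    have "gram K ?e ?e = gram K a a + cnj ?t * gram K a b
        + (?t * cnj (gram K a b) + ?t * (cnj ?t * gram K b b))"
      by (simp only: gram_append_left gram_append_right gram_scale_left gram_scale_right
          gram_cnj[of b a]) (simp add: algebra_simps)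
    also have "\<dots> = gram K a a - 2 * of_real s * (gram K a b * cnj (gram K a b))
        + (of_real s)\<^sup>2 * (gram K a b * cnj (gram K a b)) * gram K b b"
      by (simp add: algebra_simps power2_eq_square)
    also have "\<dots> = gram K a a - of_real (2 * s * ?q) + of_real (s\<^sup>2 * ?q) * gram K b b"
      by (simp add: complex_norm_square[symmetric])
    finally have "Re (gram K ?e ?e) = Re (gram K a a) - 2 * s * ?q + s\<^sup>2 * ?q * Re (gram K b b)"
      by simp
    then show ?thesis
      using psd[of ?e] by simp
  qed
  then have "?q \<le> Re (gram K a a) * Re (gram K b b)"
    by (rule discriminant_bound) (auto simp: psd)
  then have "?q \<le> (knorm a * knorm b)\<^sup>2"
    by (simp add: power_mult_distrib knorm_sq)
  then show ?thesis
    by (rule power2_le_imp_le) simp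
qed

text \<open>The least such \<open>C\<close> is the dual norm of \<open>f\<close>, viewed as a
  functional on combinations of kernel functions. It makes sense for every function, before any
  inner product on functions is available.\<close>

definition bounded_by :: "('x \<Rightarrow> complex) \<Rightarrow> real \<Rightarrow> bool"
  where "bounded_by f C \<longleftrightarrow> (\<forall>a. cmod (pairing f a) \<le> C * knorm a)"

lemma bounded_byD: "bounded_by f C \<Longrightarrow> cmod (pairing f a) \<le> C * knorm a"
  by (simp add: bounded_by_def)

lemma bounded_by_add: "bounded_by f C \<Longrightarrow> bounded_by g D \<Longrightarrow> bounded_by (f + g) (C + D)"
  unfolding bounded_by_def
  by (auto simp: pairing_add algebra_simps intro: order_trans[OF norm_triangle_ineq] add_mono)

lemma bounded_by_scale:
  assumes "bounded_by f C"
  shows "bounded_by (\<lambda>x. t * f x) (cmod t * C)"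
  using assms unfolding bounded_by_def
  by (auto simp: pairing_cmult norm_mult mult.assoc intro: mult_left_mono)

lemma bounded_by_uminus: "bounded_by (f - g) C \<Longrightarrow> bounded_by (g - f) C"
  unfolding bounded_by_def by (simp add: pairing_diff norm_minus_commute)

lemma bounded_by_mono: "bounded_by f C \<Longrightarrow> C \<le> D \<Longrightarrow> bounded_by f D"
  unfolding bounded_by_def by (meson order_trans mult_right_mono knorm_nonneg)

lemma bounded_by_comb: "bounded_by (comb (section_at K) a) (knorm a)"
  unfolding bounded_by_def gram_def[symmetric] by (simp add: gram_cauchy_schwarz)

lemma bounded_by_zero: "bounded_by 0 0"
  by (simp add: bounded_by_def pairing_zero)

text \<open>Test the bound on \<open>a\<close> itself and cancel one factor. When
  \<open>knorm a = 0\<close>, this test says nothing about the sign of \<open>C\<close>, hence the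
  maximum.\<close>

lemma knorm_le:
  assumes "bounded_by (comb (section_at K) a) C"
  shows "knorm a \<le> max C 0"
proof -
  have "cmod (gram K a a) \<le> C * knorm a"
    using assms unfolding gram_def by (rule bounded_byD)
  then have "knorm a * knorm a \<le> C * knorm a"
    using complex_Re_le_cmod[of "gram K a a"] by (simp add: knorm_sq[symmetric] power2_eq_square)
  then show ?thesis
    using knorm_nonneg[of a] by (cases "knorm a = 0") (auto simp: le_max_iff_disj)
qed

text \<open>
  The closure of the span of the kernel functions with respect to the dual norm. Its members come with
  pointwise values, which makes completeness a matter of pointwise limits.
\<close>

definition space :: "('x \<Rightarrow> complex) set"
  where "space = {f. \<forall>e>0. \<exists>a. bounded_by (f - comb (section_at K) a) e}"

definition approx :: "('x \<Rightarrow> complex) \<Rightarrow> nat \<Rightarrow> (complex \<times> 'x) list"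
  where "approx f n = (SOME a. bounded_by (f - comb (section_at K) a) (1 / real (Suc n)))"

text \<open>Only the second argument is approximated, so additivity and homogeneity in
  \<open>f\<close> are inherited from \<open>pairing\<close>. Conjugate symmetry needs the symmetric
  description in \<open>inner_tendsto_gram\<close>.\<close>

definition inner :: "('x \<Rightarrow> complex) \<Rightarrow> ('x \<Rightarrow> complex) \<Rightarrow> complex"
  where "inner f g = lim (\<lambda>n. pairing f (approx g n))"

lemma approx:
  assumes "f \<in> space"
  shows "bounded_by (f - comb (section_at K) (approx f n)) (1 / real (Suc n))"
proof -
  have "0 < 1 / real (Suc n)"
    by simp
  then show ?thesis
    using assms unfolding space_def approx_def mem_Collect_eq by (metis (mono_tags, lifting) someI_ex)
qed

lemma space_bounded:
  assumes "f \<in> space"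
  obtains C where "0 \<le> C" "bounded_by f C"
proof -
  have "bounded_by (f - comb (section_at K) (approx f 0) + comb (section_at K) (approx f 0))
      (1 / real (Suc 0) + knorm (approx f 0))"
    by (intro bounded_by_add approx assms bounded_by_comb)
  then show ?thesis
    by (intro that[of "1 + knorm (approx f 0)"]) auto
qed

text \<open>Triangle inequality through \<open>f\<close> in the dual norm, which
  \<open>knorm_le\<close> turns into an estimate of the seminorm. This is what makes the
  approximants of a function a Cauchy sequence.\<close>

lemma comb_approx_diff:
  assumes "bounded_by (f - comb (section_at K) a) e" "bounded_by (f - comb (section_at K) b) d"
    "0 \<le> e" "0 \<le> d"
  shows "knorm (a @ weight (\<lambda>_. -1) b) \<le> e + d"
proof -
  have "bounded_by ((comb (section_at K) a - f) + (f - comb (section_at K) b)) (e + d)"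
    using assms by (intro bounded_by_add) (auto intro: bounded_by_uminus)
  also have "(comb (section_at K) a - f) + (f - comb (section_at K) b)
      = comb (section_at K) (a @ weight (\<lambda>_. -1) b)"
    by (simp add: comb_append comb_weight_const fun_eq_iff)
  finally show ?thesis
    using knorm_le assms by fastforce
qed

lemma pairing_difference:
  "pairing f a - pairing f b = pairing f (a @ weight (\<lambda>_. -1) b)"
  by (simp add: pairing_append pairing_weight_const)

lemma LIMSEQ_inverse_Suc_mult: "(\<lambda>n. C * (1 / real (Suc n))) \<longlonglongrightarrow> 0"
  using tendsto_mult_right_zero[OF LIMSEQ_inverse_real_of_nat, of C] by (simp add: inverse_eq_divide)

text \<open>A bounded functional maps the Cauchy sequence of approximants to a Cauchy sequence of
  numbers, so the \<open>lim\<close> in the definition is a genuine limit.\<close>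

lemma inner_tendsto:
  assumes f: "f \<in> space" and g: "g \<in> space"
  shows "(\<lambda>n. pairing f (approx g n)) \<longlonglongrightarrow> inner f g"
proof -
  obtain C where C: "0 \<le> C" "bounded_by f C"
    using space_bounded[OF f] .
  have le: "cmod (pairing f (approx g m) - pairing f (approx g n))
      \<le> C * (1 / real (Suc m) + 1 / real (Suc n))" for m n
  proof -
    have "cmod (pairing f (approx g m) - pairing f (approx g n))
        \<le> C * knorm (approx g m @ weight (\<lambda>_. -1) (approx g n))"
      unfolding pairing_difference using C by (intro bounded_byD)
    also have "\<dots> \<le> C * (1 / real (Suc m) + 1 / real (Suc n))"
      using C by (intro mult_left_mono comb_approx_diff[OF approx[OF g] approx[OF g]]) auto
    finally show ?thesis .
  qed
  have "Cauchy (\<lambda>n. pairing f (approx g n))"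
  proof (rule metric_CauchyI)
    fix e :: real assume "e > 0"
    have "eventually (\<lambda>n. 2 * C * (1 / real (Suc n)) < e) sequentially"
      using LIMSEQ_inverse_Suc_mult[of "2 * C"] \<open>e > 0\<close> by (rule order_tendstoD)
    then obtain N where N: "2 * C * (1 / real (Suc N)) < e"
      by (auto simp: eventually_sequentially)
    have "dist (pairing f (approx g m)) (pairing f (approx g n)) < e" if "m \<ge> N" "n \<ge> N" for m n
    proof -
      have "C * (1 / real (Suc m) + 1 / real (Suc n)) \<le> C * (1 / real (Suc N) + 1 / real (Suc N))"
        using that C by (intro mult_left_mono add_mono) (auto simp: frac_le)
      then show ?thesis
        using le[of m n] N unfolding dist_norm by (simp add: algebra_simps)
    qed
    then show "\<exists>M. \<forall>m\<ge>M. \<forall>n\<ge>M. dist (pairing f (approx g m)) (pairing f (approx g n)) < e"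
      by blast
  qed
  then show ?thesis
    unfolding inner_def by (simp add: Cauchy_convergent_iff convergent_LIMSEQ_iff)
qed

lemma knorm_approx_le:
  assumes "f \<in> space"
  obtains C where "0 \<le> C" "\<forall>n. knorm (approx f n) \<le> C"
proof -
  obtain C where C: "0 \<le> C" "bounded_by f C"
    using space_bounded[OF assms] .
  have "knorm (approx f n) \<le> C + 1" for n
  proof -
    have "bounded_by ((comb (section_at K) (approx f n) - f) + f) (1 / real (Suc n) + C)"
      using C approx[OF assms] by (intro bounded_by_add) (auto intro: bounded_by_uminus)
    then have "bounded_by (comb (section_at K) (approx f n)) (1 / real (Suc n) + C)"
      by (simp only: diff_add_cancel)
    then have "bounded_by (comb (section_at K) (approx f n)) (1 + C)"
      by (intro bounded_by_mono[where D = "1 + C"]) auto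
    then show ?thesis
      using knorm_le[of "approx f n" "1 + C"] C by simp
  qed
  then show ?thesis
    using that[of "C + 1"] C by auto
qed

text \<open>Replacing \<open>f\<close> by its approximant costs at most 1 / (n + 1) times the
  seminorm of the approximant of \<open>g\<close>, and these seminorms stay bounded.\<close>

lemma inner_tendsto_gram:
  assumes f: "f \<in> space" and g: "g \<in> space"
  shows "(\<lambda>n. gram K (approx f n) (approx g n)) \<longlonglongrightarrow> inner f g"
proof -
  obtain C where C: "0 \<le> C" "\<forall>n. knorm (approx g n) \<le> C"
    using knorm_approx_le[OF g] .
  have "(\<lambda>n. pairing f (approx g n) - gram K (approx f n) (approx g n)) \<longlonglongrightarrow> 0"
  proof (rule Lim_null_comparison[OF always_eventually LIMSEQ_inverse_Suc_mult[of C]], rule allI)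
    fix n
    have "cmod (pairing f (approx g n) - gram K (approx f n) (approx g n))
        \<le> 1 / real (Suc n) * knorm (approx g n)"
      unfolding gram_def pairing_diff[symmetric] by (intro bounded_byD approx f)
    also have "\<dots> \<le> 1 / real (Suc n) * C"
      using C by (intro mult_left_mono) auto
    finally show "cmod (pairing f (approx g n) - gram K (approx f n) (approx g n))
        \<le> C * (1 / real (Suc n))"
      by (simp add: mult.commute)
  qed
  from tendsto_diff[OF inner_tendsto[OF f g] this] show ?thesis
    by simp
qed

lemma inner_cnj:
  assumes "f \<in> space" "g \<in> space"
  shows "inner g f = cnj (inner f g)"
  using inner_tendsto_gram[OF assms(2,1)] tendsto_cnj[OF inner_tendsto_gram[OF assms]]
  by (simp add: gram_cnj[of _ "approx f _"] LIMSEQ_unique)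

lemma knorm_approx_tendsto:
  assumes "f \<in> space"
  shows "(\<lambda>n. knorm (approx f n)) \<longlonglongrightarrow> sqrt (Re (inner f f))"
  unfolding knorm_def by (intro tendsto_intros inner_tendsto_gram assms)

lemma bounded_by_norm:
  assumes "f \<in> space"
  shows "bounded_by f (sqrt (Re (inner f f)))"
  unfolding bounded_by_def
proof
  fix a
  have "(\<lambda>n. (1 / real (Suc n) + knorm (approx f n)) * knorm a)
      \<longlonglongrightarrow> (0 + sqrt (Re (inner f f))) * knorm a"
    using LIMSEQ_inverse_Suc_mult[of 1] by (intro tendsto_intros knorm_approx_tendsto assms) simp
  moreover have "cmod (pairing f a) \<le> (1 / real (Suc n) + knorm (approx f n)) * knorm a" for n
  proof -
    have "bounded_by ((f - comb (section_at K) (approx f n)) + comb (section_at K) (approx f n))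
        (1 / real (Suc n) + knorm (approx f n))"
      by (intro bounded_by_add approx assms bounded_by_comb)
    then show ?thesis
      by (simp add: bounded_by_def)
  qed
  ultimately show "cmod (pairing f a) \<le> sqrt (Re (inner f f)) * knorm a"
    by (intro LIMSEQ_le_const) auto
qed

text \<open>Pairing \<open>f\<close> with its own approximants gives ||f||^2 <= C ||f|| in the
  limit. With \<open>bounded_by_norm\<close>, the norm of \<open>inner\<close> is the dual norm, so
  completeness can be argued with \<open>bounded_by\<close> alone.\<close>

lemma norm_le:
  assumes f: "f \<in> space" and C: "0 \<le> C" "bounded_by f C"
  shows "sqrt (Re (inner f f)) \<le> C"
proof -
  let ?n = "sqrt (Re (inner f f))"
  have "cmod (inner f f) \<le> C * ?n"
    by (rule LIMSEQ_le[OF tendsto_norm[OF inner_tendsto[OF f f]]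
          tendsto_mult_left[OF knorm_approx_tendsto[OF f], of C]]) (auto intro: bounded_byD C)
  moreover have "0 \<le> ?n"
    by (rule LIMSEQ_le_const[OF knorm_approx_tendsto[OF f]]) auto
  then have "?n * ?n = Re (inner f f)"
    by simp
  ultimately have "?n * ?n \<le> C * ?n"
    using complex_Re_le_cmod[of "inner f f"] by simp
  then show ?thesis
    using C self_mult_le_imp_le by blast
qed

lemma space_zero: "0 \<in> space"
  unfolding space_def mem_Collect_eq
  by (auto simp: fun_diff_def bounded_by_def intro!: exI[of _ "[]"] mult_nonneg_nonneg)

lemma space_add:
  assumes f: "f \<in> space" and g: "g \<in> space"
  shows "f + g \<in> space"
  unfolding space_def mem_Collect_eq
proof (intro allI impI)
  fix e :: real assume "0 < e"
  then have "0 < e / 2"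
    by simp
  then obtain a b where ab: "bounded_by (f - comb (section_at K) a) (e / 2)"
      "bounded_by (g - comb (section_at K) b) (e / 2)"
    using f g unfolding space_def mem_Collect_eq by metis
  have "bounded_by ((f - comb (section_at K) a) + (g - comb (section_at K) b)) (e / 2 + e / 2)"
    by (intro bounded_by_add ab)
  also have "(f - comb (section_at K) a) + (g - comb (section_at K) b)
      = f + g - comb (section_at K) (a @ b)"
    by (simp add: comb_append)
  finally show "\<exists>a. bounded_by (f + g - comb (section_at K) a) e"
    by (intro exI[of _ "a @ b"]) (simp only: field_sum_of_halves)
qed

lemma space_scale:
  assumes f: "f \<in> space"
  shows "(\<lambda>x. t * f x) \<in> space"
  unfolding space_def mem_Collect_eq
proof (intro allI impI)
  fix e :: real assume e: "0 < e"
  have pos: "0 < cmod t + 1"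
    by (simp add: add_nonneg_pos)
  then have "0 < e / (cmod t + 1)"
    using e by simp
  then obtain a where a: "bounded_by (f - comb (section_at K) a) (e / (cmod t + 1))"
    using f unfolding space_def mem_Collect_eq by metis
  have "bounded_by (\<lambda>x. t * (f - comb (section_at K) a) x) e"
    using bounded_by_scale[OF a, of t] by (rule bounded_by_mono) (use e pos in \<open>simp add: field_simps\<close>)
  also have "(\<lambda>x. t * (f - comb (section_at K) a) x)
      = (\<lambda>x. t * f x) - comb (section_at K) (weight (\<lambda>_. t) a)"
    by (simp add: comb_weight_const fun_eq_iff algebra_simps)
  finally show "\<exists>a. bounded_by ((\<lambda>x. t * f x) - comb (section_at K) a) e"
    by (intro exI[of _ "weight (\<lambda>_. t) a"])
qed

lemma space_diff: "f \<in> space \<Longrightarrow> g \<in> space \<Longrightarrow> f - g \<in> space"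
  using space_add[of f "\<lambda>x. -1 * g x"] space_scale[of g "-1"]
  by (simp add: plus_fun_def fun_diff_def)

lemma space_section: "section_at K w \<in> space"
proof -
  have "section_at K w - comb (section_at K) [(1, w)] = 0"
    by (simp add: comb_Cons fun_eq_iff)
  then show ?thesis
    unfolding space_def mem_Collect_eq
    using bounded_by_mono[OF bounded_by_zero, OF less_imp_le] by (auto intro!: exI[of _ "[(1, w)]"])
qed

text \<open>The list \<open>[(1, w)]\<close> represents the kernel function with error 0, so the
  chosen approximants may be exchanged for it in the limit; pairing with this list is evaluation at
  \<open>w\<close>.\<close>

lemma inner_section:
  assumes f: "f \<in> space"
  shows "inner f (section_at K w) = f w"
proof -
  obtain C where C: "0 \<le> C" "bounded_by f C"
    using space_bounded[OF f] .
  let ?a = "approx (section_at K w)"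
  have 0: "bounded_by (section_at K w - comb (section_at K) [(1, w)]) 0"
  proof -
    have "section_at K w - comb (section_at K) [(1, w)] = 0"
      by (simp add: comb_Cons fun_eq_iff)
    then show ?thesis
      using bounded_by_zero by metis
  qed
  have "(\<lambda>n. pairing f (?a n) - pairing f [(1, w)]) \<longlonglongrightarrow> 0"
  proof (rule Lim_null_comparison[OF always_eventually LIMSEQ_inverse_Suc_mult[of C]], rule allI)
    fix n
    have "cmod (pairing f (?a n) - pairing f [(1, w)])
        \<le> C * knorm (?a n @ weight (\<lambda>_. -1) [(1, w)])"
      unfolding pairing_difference by (intro bounded_byD C)
    also have "\<dots> \<le> C * (1 / real (Suc n) + 0)"
      using C comb_approx_diff[OF approx[OF space_section] 0, of n] by (intro mult_left_mono) auto
    finally show "cmod (pairing f (?a n) - pairing f [(1, w)]) \<le> C * (1 / real (Suc n))"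
      by simp
  qed
  then have "(\<lambda>n. pairing f (?a n)) \<longlonglongrightarrow> f w"
    by (simp add: LIM_zero_iff)
  then show ?thesis
    using inner_tendsto[OF f space_section] LIMSEQ_unique by blast
qed

lemma space_complete:
  fixes s :: "nat \<Rightarrow> 'x \<Rightarrow> complex"
  assumes s: "\<And>n. s n \<in> space"
    and cauchy: "\<forall>e>0. \<exists>N. \<forall>m\<ge>N. \<forall>n\<ge>N. sqrt (Re (inner (s m - s n) (s m - s n))) < e"
  shows "\<exists>f\<in>space. (\<lambda>n. sqrt (Re (inner (s n - f) (s n - f)))) \<longlonglongrightarrow> 0"
proof -
  have bd: "\<exists>N. \<forall>m\<ge>N. \<forall>n\<ge>N. bounded_by (s m - s n) e" if "e > 0" for e
    using cauchy that bounded_by_norm[OF space_diff[OF s s]] by (meson bounded_by_mono less_imp_le)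
  \<comment> \<open>Evaluation at \<open>w\<close> is the pairing with \<open>[(1, w)]\<close>, so
    Cauchy in the dual norm implies Cauchy at each point. Adding 1 to \<open>?k\<close> avoids a
    division by zero.\<close>
  have "Cauchy (\<lambda>n. s n w)" for w
  proof (rule metric_CauchyI)
    fix e :: real assume "e > 0"
    let ?k = "knorm [(1, w)]"
    have pos: "0 < ?k + 1"
      by (simp add: add_nonneg_pos)
    then obtain N where N: "\<forall>m\<ge>N. \<forall>n\<ge>N. bounded_by (s m - s n) (e / (?k + 1))"
      using bd[of "e / (?k + 1)"] \<open>e > 0\<close> by auto
    have "dist (s m w) (s n w) < e" if "m \<ge> N" "n \<ge> N" for m n
    proof -
      have "cmod (pairing (s m - s n) [(1, w)]) \<le> e / (?k + 1) * ?k"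
        using N that by (intro bounded_byD) auto
      also have "\<dots> < e"
        using \<open>e > 0\<close> pos by (simp add: field_simps)
      finally show ?thesis
        by (simp add: dist_norm)
    qed
    then show "\<exists>M. \<forall>m\<ge>M. \<forall>n\<ge>M. dist (s m w) (s n w) < e"
      by blast
  qed
  then have "\<exists>f. \<forall>w. (\<lambda>n. s n w) \<longlonglongrightarrow> f w"
    by (intro choice) (auto simp: Cauchy_convergent_iff convergent_def)
  then obtain f where f: "\<And>w. (\<lambda>n. s n w) \<longlonglongrightarrow> f w"
    by blast
  \<comment> \<open>For a fixed list the bound involves finitely many values of the functions, so it
    survives the pointwise limit in the second index.\<close>
  have lim: "\<exists>N. \<forall>n\<ge>N. bounded_by (s n - f) e" if "0 < e" for e
  proof -
    obtain N where N: "\<forall>m\<ge>N. \<forall>n\<ge>N. bounded_by (s m - s n) e"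
      using bd[OF \<open>0 < e\<close>] by blast
    have "bounded_by (s n - f) e" if "n \<ge> N" for n
      unfolding bounded_by_def
    proof
      fix a
      have "(\<lambda>m. cmod (pairing (s n - s m) a)) \<longlonglongrightarrow> cmod (pairing (s n - f) a)"
        unfolding fun_diff_def by (intro tendsto_norm tendsto_pairing tendsto_intros f)
      moreover have "cmod (pairing (s n - s m) a) \<le> e * knorm a" if "m \<ge> N" for m
        using N \<open>n \<ge> N\<close> that by (intro bounded_byD) auto
      ultimately show "cmod (pairing (s n - f) a) \<le> e * knorm a"
        by (intro LIMSEQ_le_const2) auto
    qed
    then show ?thesis
      by blast
  qed
  have fs: "f \<in> space"
    unfolding space_def mem_Collect_eq
  proof (intro allI impI)
    fix e :: real assume "0 < e"
    then have e: "0 < e / 2"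
      by simp
    then obtain n where n: "bounded_by (s n - f) (e / 2)"
      using lim by blast
    obtain a where a: "bounded_by (s n - comb (section_at K) a) (e / 2)"
      using s[of n] e unfolding space_def mem_Collect_eq by metis
    have "bounded_by ((f - s n) + (s n - comb (section_at K) a)) (e / 2 + e / 2)"
      using n a by (intro bounded_by_add) (auto intro: bounded_by_uminus)
    then show "\<exists>a. bounded_by (f - comb (section_at K) a) e"
      by auto
  qed
  moreover have "(\<lambda>n. sqrt (Re (inner (s n - f) (s n - f)))) \<longlonglongrightarrow> 0"
  proof (rule LIMSEQ_I)
    fix e :: real assume "0 < e"
    then have e: "0 < e / 2"
      by simp
    then obtain N where N: "\<forall>n\<ge>N. bounded_by (s n - f) (e / 2)"
      using lim by blast
    have "norm (sqrt (Re (inner (s n - f) (s n - f))) - 0) < e" if "n \<ge> N" for n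
    proof -
      have "0 \<le> sqrt (Re (inner (s n - f) (s n - f)))"
        by (rule LIMSEQ_le_const[OF knorm_approx_tendsto]) (auto intro: space_diff s fs)
      moreover have "sqrt (Re (inner (s n - f) (s n - f))) \<le> e / 2"
        using N that e by (intro norm_le space_diff s fs) auto
      ultimately show ?thesis
        using e by simp
    qed
    then show "\<exists>N. \<forall>n\<ge>N. norm (sqrt (Re (inner (s n - f) (s n - f))) - 0) < e"
      by blast
  qed
  ultimately show ?thesis
    by blast
qed

theorem rkhs_space_inner: "rkhs K space inner"
proof
  fix f g h :: "'x \<Rightarrow> complex" assume f: "f \<in> space" and g: "g \<in> space" and h: "h \<in> space"
  have "(\<lambda>n. pairing f (approx h n) + pairing g (approx h n)) \<longlonglongrightarrow> inner f h + inner g h"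
    by (intro tendsto_intros inner_tendsto f g h)
  then show "inner (f + g) h = inner f h + inner g h"
    using inner_tendsto[OF space_add[OF f g] h] by (simp add: pairing_add LIMSEQ_unique)
next
  fix c and f g :: "'x \<Rightarrow> complex" assume f: "f \<in> space" and g: "g \<in> space"
  have "(\<lambda>n. c * pairing f (approx g n)) \<longlonglongrightarrow> c * inner f g"
    by (intro tendsto_intros inner_tendsto f g)
  then show "inner (\<lambda>x. c * f x) g = c * inner f g"
    using inner_tendsto[OF space_scale[OF f] g, of c] by (simp add: pairing_cmult LIMSEQ_unique)
next
  fix f assume f: "f \<in> space"
  have "(\<lambda>n. Re (gram K (approx f n) (approx f n))) \<longlonglongrightarrow> Re (inner f f)"
    by (intro tendsto_intros inner_tendsto_gram f)
  then show "0 \<le> Re (inner f f)"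
    by (rule LIMSEQ_le_const) (auto simp: psd)
next
  fix f assume f: "f \<in> space" and "inner f f = 0"
  then have "bounded_by f 0"
    using bounded_by_norm[OF f] by simp
  then show "f = 0"
    using bounded_byD[of f 0 "[(1, _)]"] by (auto simp: fun_eq_iff)
next
  show "(\<lambda>z. K z w) \<in> space" for w
    using space_section by (simp add: section_at_def)
next
  show "f \<in> space \<Longrightarrow> inner f (\<lambda>z. K z w) = f w" for f w
    using inner_section by (simp add: section_at_def)
qed (auto intro: space_zero space_add space_scale inner_cnj space_complete)

end

text \<open>The existence half of Moore-Aronszajn shows that the choice in \<open>rkhs_of\<close> is
  made from a nonempty collection. From here on the chosen space is accessible only through the
  axioms of \<open>rkhs\<close>.\<close>

lemma rkhs_rkhs_of:
  assumes "psd_kernel K"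
  shows "rkhs K (rkhs_space K) (snd (rkhs_of K))"
proof -
  have "case rkhs_of K of (H, ip) \<Rightarrow> rkhs K H ip"
    unfolding rkhs_of_def
    by (rule someI[of _ "(psd_kernel.space K, psd_kernel.inner K)"])
      (simp add: psd_kernel.rkhs_space_inner[OF assms])
  then show ?thesis
    by (simp add: rkhs_space_def case_prod_unfold)
qed

section \<open>Geometry of reproducing kernel Hilbert spaces\<close>

context rkhs
begin

definition nrm :: "('x \<Rightarrow> complex) \<Rightarrow> real"
  where "nrm f = sqrt (Re (ip f f))"

lemma kernel_section_mem: "section_at K w \<in> H"
  using kernel_mem by (simp add: section_at_def)

lemma ip_kernel_section: "f \<in> H \<Longrightarrow> ip f (section_at K w) = f w"
  using reproducing by (simp add: section_at_def)

lemma diff_mem: "f \<in> H \<Longrightarrow> g \<in> H \<Longrightarrow> f - g \<in> H"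
  using add_mem[of f "\<lambda>x. -1 * g x"] scale_mem[of g "-1"]
  by (simp add: plus_fun_def fun_diff_def)

lemma ip_diff:
  assumes "f \<in> H" "g \<in> H" "h \<in> H"
  shows "ip (f - g) h = ip f h - ip g h"
proof -
  have "f - g = f + (\<lambda>x. -1 * g x)"
    by (simp add: fun_eq_iff)
  then show ?thesis
    using assms by (simp only: ip_add scale_mem ip_scale) simp
qed

lemma ip_add_right: "f \<in> H \<Longrightarrow> g \<in> H \<Longrightarrow> h \<in> H \<Longrightarrow> ip h (f + g) = ip h f + ip h g"
  by (simp add: ip_commute[of _ h] ip_add add_mem)

lemma ip_diff_right: "f \<in> H \<Longrightarrow> g \<in> H \<Longrightarrow> h \<in> H \<Longrightarrow> ip h (f - g) = ip h f - ip h g"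
  by (simp add: ip_commute[of _ h] ip_diff diff_mem)

lemma ip_scale_right: "f \<in> H \<Longrightarrow> g \<in> H \<Longrightarrow> ip g (\<lambda>x. c * f x) = cnj c * ip g f"
  by (simp add: ip_commute[of _ g] ip_scale scale_mem)

lemma ip_zero: "f \<in> H \<Longrightarrow> ip 0 f = 0"
  using ip_diff[of f f f] by simp

lemma nrm_nonneg: "f \<in> H \<Longrightarrow> 0 \<le> nrm f"
  by (simp add: nrm_def ip_nonneg)

lemma nrm_sq: "f \<in> H \<Longrightarrow> (nrm f)\<^sup>2 = Re (ip f f)"
  by (simp add: nrm_def ip_nonneg)

lemma ip_self: "f \<in> H \<Longrightarrow> ip f f = of_real ((nrm f)\<^sup>2)"
  using ip_commute[of f f] by (simp add: nrm_sq complex_eq_iff)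

lemma nrm_eq_0: "f \<in> H \<Longrightarrow> nrm f = 0 \<Longrightarrow> f = 0"
  using ip_definite ip_self by simp

lemma nrm_scale: "f \<in> H \<Longrightarrow> nrm (\<lambda>x. c * f x) = cmod c * nrm f"
proof -
  assume f: "f \<in> H"
  have "ip (\<lambda>x. c * f x) (\<lambda>x. c * f x) = (c * cnj c) * ip f f"
    using f by (simp add: ip_scale ip_scale_right scale_mem)
  also have "\<dots> = of_real ((cmod c * nrm f)\<^sup>2)"
    by (simp add: complex_norm_square[symmetric] ip_self[OF f] power_mult_distrib)
  finally have "Re (ip (\<lambda>x. c * f x) (\<lambda>x. c * f x)) = (cmod c * nrm f)\<^sup>2"
    by (metis Re_complex_of_real)
  then show ?thesis
    by (simp add: nrm_def real_sqrt_mult ip_nonneg f nrm_nonneg)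
qed

lemma nrm_add_sq:
  assumes "f \<in> H" "g \<in> H"
  shows "(nrm (f + g))\<^sup>2 = (nrm f)\<^sup>2 + 2 * Re (ip f g) + (nrm g)\<^sup>2"
  using assms by (simp add: nrm_sq add_mem ip_add ip_add_right ip_commute[of f g])

lemma nrm_diff_sq:
  assumes "f \<in> H" "g \<in> H"
  shows "(nrm (f - g))\<^sup>2 = (nrm f)\<^sup>2 - 2 * Re (ip f g) + (nrm g)\<^sup>2"
  using assms by (simp add: nrm_sq diff_mem ip_diff ip_diff_right ip_commute[of f g])

lemma cauchy_schwarz:
  assumes f: "f \<in> H" and g: "g \<in> H"
  shows "cmod (ip f g) \<le> nrm f * nrm g"
proof -
  let ?q = "(cmod (ip f g))\<^sup>2"
  have "0 \<le> (nrm f)\<^sup>2 - 2 * s * ?q + s\<^sup>2 * ?q * (nrm g)\<^sup>2" for s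
  proof -
    let ?t = "of_real s * ip f g"
    have tg: "(\<lambda>x. ?t * g x) \<in> H"
      by (intro scale_mem g)
    have "ip f (\<lambda>x. ?t * g x) = of_real s * (ip f g * cnj (ip f g))"
      using f g by (simp add: ip_scale_right)
    then have "Re (ip f (\<lambda>x. ?t * g x)) = s * ?q"
      by (simp add: complex_norm_square[symmetric] flip: of_real_power)
    then have "(nrm (f - (\<lambda>x. ?t * g x)))\<^sup>2 = (nrm f)\<^sup>2 - 2 * s * ?q + s\<^sup>2 * ?q * (nrm g)\<^sup>2"
      by (simp add: nrm_diff_sq[OF f tg] nrm_scale[OF g] norm_mult power_mult_distrib)
    then show ?thesis
      by (metis zero_le_power2)
  qed
  then have "?q \<le> (nrm f)\<^sup>2 * (nrm g)\<^sup>2"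
    by (rule discriminant_bound) auto
  then have "?q \<le> (nrm f * nrm g)\<^sup>2"
    by (simp add: power_mult_distrib)
  then show ?thesis
    by (rule power2_le_imp_le) (simp add: nrm_nonneg f g)
qed

lemma comb_mem:
  assumes "\<And>x. \<phi> x \<in> H"
  shows "comb \<phi> a \<in> H"
  by (induction a)
    (auto simp: comb_Cons zero_mem[unfolded zero_fun_def] intro!: add_mem scale_mem assms)

lemma ip_comb_right:
  assumes "f \<in> H" "\<And>x. \<phi> x \<in> H"
  shows "ip f (comb \<phi> a) = pairing (\<lambda>x. ip f (\<phi> x)) a"
proof (induction a)
  case Nil
  show ?case
    using ip_commute[OF zero_mem assms(1)] ip_zero[OF assms(1)] by (simp add: zero_fun_def)
next
  case (Cons p a)
  then show ?case
    by (cases p) (simp only: comb_Cons ip_add_right ip_scale_right scale_mem comb_mem assms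
        pairing_Cons)
qed

lemma ip_comb_comb:
  assumes "\<And>x. \<phi> x \<in> H"
  shows "ip (comb \<phi> a) (comb \<phi> b) = cnj (pairing (\<lambda>y. cnj (pairing (\<lambda>x. ip (\<phi> y) (\<phi> x)) b)) a)"
proof -
  have "ip (comb \<phi> a) (comb \<phi> b) = cnj (ip (comb \<phi> b) (comb \<phi> a))"
    by (intro ip_commute comb_mem assms)
  also have "ip (comb \<phi> b) (comb \<phi> a) = pairing (\<lambda>y. cnj (ip (\<phi> y) (comb \<phi> b))) a"
    by (simp add: ip_comb_right comb_mem assms ip_commute[OF _ comb_mem[OF assms], OF assms])
  finally show ?thesis
    by (simp add: ip_comb_right assms)
qed

lemma ip_comb_section: "f \<in> H \<Longrightarrow> ip f (comb (section_at K) a) = pairing f a"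
  by (simp add: ip_comb_right kernel_section_mem ip_kernel_section)

lemma cmod_le_nrm: "f \<in> H \<Longrightarrow> cmod (f w) \<le> nrm f * nrm (section_at K w)"
  using cauchy_schwarz[OF _ kernel_section_mem] by (simp add: ip_kernel_section)

lemma parallelogram:
  assumes f: "f \<in> H" and g: "g \<in> H"
  shows "(nrm (f - g))\<^sup>2 = 2 * (nrm f)\<^sup>2 + 2 * (nrm g)\<^sup>2 - 4 * (nrm (\<lambda>x. (1 / 2) * (f + g) x))\<^sup>2"
  using assms unfolding nrm_scale[OF add_mem[OF assms]] power_mult_distrib nrm_add_sq[OF assms]
  by (simp add: nrm_diff_sq power2_eq_square[of "1/2"] norm_divide power_divide add_divide_distrib)

text \<open>
  The representing vector is the limit of a minimizing sequence of
  \<open>\<parallel>comb \<phi> a\<parallel>\<^sup>2 - 2 Re (pairing F a)\<close>.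
\<close>

lemma riesz_features:
  fixes \<phi> :: "'i \<Rightarrow> 'x \<Rightarrow> complex"
  assumes \<phi>: "\<And>x. \<phi> x \<in> H"
    and bound: "\<And>a. cmod (pairing F a) \<le> C * nrm (comb \<phi> a)"
  obtains v where "v \<in> H" "\<And>x. ip v (\<phi> x) = F x" "nrm v \<le> max C 0"
proof -
  let ?S = "comb \<phi>"
  note S = comb_mem[of \<phi>, OF \<phi>]
  define J where "J a = (nrm (?S a))\<^sup>2 - 2 * Re (pairing F a)" for a
  \<comment> \<open>Completing the square: J(a) >= ||S||^2 - 2 C ||S|| >= - C^2, where S is the
    combination of \<open>a\<close>.\<close>
  have lower: "- C\<^sup>2 \<le> J a" for a
  proof -
    have "Re (pairing F a) \<le> C * nrm (?S a)"
      using bound[of a] complex_Re_le_cmod order_trans by blast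
    moreover have "0 \<le> (nrm (?S a) - C)\<^sup>2"
      by simp
    ultimately show ?thesis
      unfolding J_def power2_diff by (simp add: mult.commute)
  qed
  define m where "m = Inf (range J)"
  have bdd: "bdd_below (range J)"
    using lower by (auto intro!: bdd_belowI)
  have m_le: "m \<le> J a" for a
    unfolding m_def by (intro cInf_lower bdd) auto
  have "\<exists>a. J a < m + 1 / real (Suc n)" for n
  proof -
    have "Inf (range J) < m + 1 / real (Suc n)"
      by (simp add: m_def)
    then show ?thesis
      using cInf_lessD[of "range J"] by blast
  qed
  then obtain s where s: "\<And>n. J (s n) < m + 1 / real (Suc n)"
    by metis
  \<comment> \<open>The midpoint of two combinations is again a combination, so its value of
    \<open>J\<close> is at least \<open>m\<close>; the parallelogram law then forces near-minimizers
    to be close to each other.\<close>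
  have para: "(nrm (?S a - ?S b))\<^sup>2 \<le> 2 * (J a - m) + 2 * (J b - m)" for a b
  proof -
    let ?c = "weight (\<lambda>_. 1 / 2) (a @ b)"
    have "?S ?c = (\<lambda>x. (1 / 2) * (?S a + ?S b) x)"
      by (simp only: comb_weight_const comb_append)
    moreover have "Re (pairing F ?c) = (Re (pairing F a) + Re (pairing F b)) / 2"
      by (simp add: pairing_weight_const pairing_append)
    ultimately have "(nrm (?S a - ?S b))\<^sup>2 = 2 * J a + 2 * J b - 4 * J ?c"
      unfolding J_def parallelogram[OF S S] by simp
    then show ?thesis
      using m_le[of ?c] by simp
  qed
  \<comment> \<open>First variation of \<open>J\<close> in the direction of one feature: a defect
    \<delta> of the equation <S, \<phi> x> = F x would allow a decrease of \<open>J\<close>, and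
    near a minimum there is little room for that.\<close>
  have near: "(cmod (ip (?S a) (\<phi> x) - F x))\<^sup>2 \<le> ((nrm (\<phi> x))\<^sup>2 + 1) * (J a - m)" for a x
  proof -
    let ?k = "(nrm (\<phi> x))\<^sup>2"
    define \<delta> where "\<delta> = ip (?S a) (\<phi> x) - F x"
    \<comment> \<open>With this step length r ||\<phi> x||^2 <= 1, so the quadratic term cancels at
      most half of the linear gain 2 r |\<delta>|^2.\<close>
    define r :: real where "r = 1 / (?k + 1)"
    have k: "0 \<le> ?k" "0 < ?k + 1"
      by (simp_all add: add_nonneg_pos)
    define t where "t = - of_real r * \<delta>"
    let ?a = "(t, x) # a"
    have eq: "Re (ip (\<lambda>y. t * \<phi> x y) (?S a)) - Re (cnj t * F x) = - (r * (cmod \<delta>)\<^sup>2)"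
    proof -
      have "Re (ip (\<lambda>y. t * \<phi> x y) (?S a)) = Re (cnj t * ip (?S a) (\<phi> x))"
        by (simp add: ip_scale S \<phi> ip_commute[OF S \<phi>])
      then have "Re (ip (\<lambda>y. t * \<phi> x y) (?S a)) - Re (cnj t * F x) = Re (cnj t * \<delta>)"
        by (simp add: \<delta>_def algebra_simps)
      also have "cnj t * \<delta> = - of_real (r * (cmod \<delta>)\<^sup>2)"
        by (simp add: t_def complex_norm_square mult.commute del: of_real_power)
      finally show ?thesis
        by simp
    qed
    have "J ?a = J a + 2 * (Re (ip (\<lambda>y. t * \<phi> x y) (?S a)) - Re (cnj t * F x)) + (cmod t)\<^sup>2 * ?k"
      by (simp add: J_def comb_Cons nrm_add_sq scale_mem S \<phi> nrm_scale power_mult_distrib)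
    also have "\<dots> = J a - 2 * r * (cmod \<delta>)\<^sup>2 + r\<^sup>2 * (cmod \<delta>)\<^sup>2 * ?k"
      unfolding eq by (simp add: t_def norm_mult power_mult_distrib)
    finally have "m \<le> J a - 2 * r * (cmod \<delta>)\<^sup>2 + r\<^sup>2 * (cmod \<delta>)\<^sup>2 * ?k"
      using m_le[of ?a] by simp
    moreover have "r\<^sup>2 * (cmod \<delta>)\<^sup>2 * ?k \<le> r * (cmod \<delta>)\<^sup>2"
    proof -
      have "r * ?k \<le> 1" "0 \<le> r"
        using k by (simp_all add: r_def)
      then have "(r * ?k) * (r * (cmod \<delta>)\<^sup>2) \<le> 1 * (r * (cmod \<delta>)\<^sup>2)"
        by (intro mult_right_mono) auto
      then show ?thesis
        by (simp add: power2_eq_square mult_ac)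
    qed
    ultimately have "r * (cmod \<delta>)\<^sup>2 \<le> J a - m"
      by simp
    then have "(?k + 1) * (r * (cmod \<delta>)\<^sup>2) \<le> (?k + 1) * (J a - m)"
      using k by (intro mult_left_mono) auto
    moreover have "(?k + 1) * r = 1"
      using k by (simp add: r_def)
    ultimately show ?thesis
      unfolding \<delta>_def by (simp add: mult.assoc[symmetric])
  qed
  have "\<exists>N. \<forall>p\<ge>N. \<forall>q\<ge>N. sqrt (Re (ip (?S (s p) - ?S (s q)) (?S (s p) - ?S (s q)))) < e"
    if "e > 0" for e
  proof -
    have "eventually (\<lambda>n. 4 * (1 / real (Suc n)) < e\<^sup>2) sequentially"
      using tendsto_mult_right_zero[OF LIMSEQ_inverse_real_of_nat, of 4] that
      by (intro order_tendstoD(2)) (auto simp: inverse_eq_divide)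
    then obtain N where N: "4 * (1 / real (Suc N)) < e\<^sup>2"
      by (auto simp: eventually_sequentially)
    have "sqrt (Re (ip (?S (s p) - ?S (s q)) (?S (s p) - ?S (s q)))) < e" if "p \<ge> N" "q \<ge> N" for p q
    proof -
      define r where "r = 1 / real (Suc N)"
      have J: "J (s n) - m < r" if "n \<ge> N" for n
      proof -
        have "J (s n) - m < 1 / real (Suc n)"
          using s[of n] by (simp only: diff_less_eq add.commute)
        also have "\<dots> \<le> r"
          using that by (simp add: r_def frac_le)
        finally show ?thesis .
      qed
      have "2 * (J (s p) - m) + 2 * (J (s q) - m) < 2 * r + 2 * r"
        by (intro add_strict_mono mult_strict_left_mono J that) auto
      also have "\<dots> < e\<^sup>2"
        using N by (simp add: r_def)
      finally have "2 * (J (s p) - m) + 2 * (J (s q) - m) < e\<^sup>2" .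
      with para have "(nrm (?S (s p) - ?S (s q)))\<^sup>2 < e\<^sup>2"
        by (rule le_less_trans)
      then have "nrm (?S (s p) - ?S (s q)) < e"
        using \<open>e > 0\<close> by (rule power2_less_imp_less[OF _ less_imp_le])
      then show ?thesis
        by (simp add: nrm_def)
    qed
    then show ?thesis
      by blast
  qed
  then obtain v where v: "v \<in> H" and lim: "(\<lambda>n. nrm (?S (s n) - v)) \<longlonglongrightarrow> 0"
    using complete[of "\<lambda>n. ?S (s n)"] S unfolding nrm_def by blast
  have ip_lim: "(\<lambda>n. ip (?S (s n)) g) \<longlonglongrightarrow> ip v g" if g: "g \<in> H" for g
  proof (rule LIM_zero_cancel, rule Lim_null_comparison[OF always_eventually], rule allI)
    show "norm (ip (?S (s n)) g - ip v g) \<le> nrm (?S (s n) - v) * nrm g" for n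
      using cauchy_schwarz[OF diff_mem[OF S v] g] by (simp add: ip_diff S v g)
    show "(\<lambda>n. nrm (?S (s n) - v) * nrm g) \<longlonglongrightarrow> 0"
      using tendsto_mult_left_zero[OF lim] .
  qed
  have rep: "ip v (\<phi> x) = F x" for x
  proof -
    have "(\<lambda>n. ((nrm (\<phi> x))\<^sup>2 + 1) * (1 / real (Suc n))) \<longlonglongrightarrow> 0"
      using tendsto_mult_right_zero[OF LIMSEQ_inverse_real_of_nat] by (simp add: inverse_eq_divide)
    moreover have "norm ((cmod (ip (?S (s n)) (\<phi> x) - F x))\<^sup>2) \<le> ((nrm (\<phi> x))\<^sup>2 + 1) * (1 / real (Suc n))" for n
    proof -
      have "((nrm (\<phi> x))\<^sup>2 + 1) * (J (s n) - m) \<le> ((nrm (\<phi> x))\<^sup>2 + 1) * (1 / real (Suc n))"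
        using s[of n] by (intro mult_left_mono) auto
      then show ?thesis
        using near[of "s n" x] by simp
    qed
    ultimately have "(\<lambda>n. (cmod (ip (?S (s n)) (\<phi> x) - F x))\<^sup>2) \<longlonglongrightarrow> 0"
      by (rule Lim_null_comparison[OF always_eventually, OF allI, rotated])
    moreover have "(\<lambda>n. (cmod (ip (?S (s n)) (\<phi> x) - F x))\<^sup>2) \<longlonglongrightarrow> (cmod (ip v (\<phi> x) - F x))\<^sup>2"
      by (intro tendsto_intros ip_lim \<phi>)
    ultimately have "(cmod (ip v (\<phi> x) - F x))\<^sup>2 = 0"
      using LIMSEQ_unique by blast
    then show ?thesis
      by simp
  qed
  \<comment> \<open>Since <v, S> for a combination S is the pairing of \<open>F\<close> with its
    list, the hypothesis applies to the minimizing sequence; in the limit it reads ||v||^2 <= C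
    ||v||.\<close>
  have "nrm v \<le> max C 0"
  proof (rule self_mult_le_imp_le)
    have "(\<lambda>n. max C 0 * nrm (?S (s n))) \<longlonglongrightarrow> max C 0 * nrm v"
    proof -
      have "(\<lambda>n. nrm (?S (s n) - v) * nrm (?S (s n) - v) + 2 * Re (ip (?S (s n)) v) - (nrm v)\<^sup>2)
          \<longlonglongrightarrow> 0 * 0 + 2 * Re (ip v v) - (nrm v)\<^sup>2"
        by (intro tendsto_intros lim ip_lim v)
      also have "(\<lambda>n. nrm (?S (s n) - v) * nrm (?S (s n) - v) + 2 * Re (ip (?S (s n)) v) - (nrm v)\<^sup>2)
          = (\<lambda>n. (nrm (?S (s n)))\<^sup>2)"
        by (simp add: power2_eq_square[symmetric] nrm_diff_sq S v)
      finally have "(\<lambda>n. sqrt ((nrm (?S (s n)))\<^sup>2)) \<longlonglongrightarrow> sqrt ((nrm v)\<^sup>2)"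
        using v by (intro tendsto_real_sqrt) (simp add: nrm_sq)
      then show ?thesis
        by (intro tendsto_intros) (simp add: nrm_nonneg S v)
    qed
    moreover have "(\<lambda>n. cmod (ip (?S (s n)) v)) \<longlonglongrightarrow> cmod (ip v v)"
      by (intro tendsto_norm ip_lim v)
    moreover have "cmod (ip (?S (s n)) v) \<le> max C 0 * nrm (?S (s n))" for n
    proof -
      have "cmod (ip (?S (s n)) v) = cmod (pairing F (s n))"
        by (simp add: ip_commute[OF v S] ip_comb_right[OF v \<phi>] rep)
      also have "\<dots> \<le> C * nrm (?S (s n))"
        by (rule bound)
      also have "\<dots> \<le> max C 0 * nrm (?S (s n))"
        by (intro mult_right_mono) (auto simp: nrm_nonneg S)
      finally show ?thesis .
    qed
    ultimately have "cmod (ip v v) \<le> max C 0 * nrm v"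
      by (intro LIMSEQ_le) auto
    then show "nrm v * nrm v \<le> max C 0 * nrm v"
      by (simp add: ip_self[OF v] norm_power power2_eq_square norm_mult)
  qed simp
  then show ?thesis
    using that v rep by blast
qed

end

text \<open>Equal Gram matrices make corresponding combinations of \<phi> and \<psi> equally long.
  Hence the functional induced by \<open>u\<close> on combinations of \<phi> is bounded by ||u|| on
  combinations of \<psi> as well, and it is represented there by a vector no longer than
  \<open>u\<close>.\<close>

lemma transfer_features:
  fixes \<phi> :: "'i \<Rightarrow> 'x \<Rightarrow> complex" and \<psi> :: "'i \<Rightarrow> 'y \<Rightarrow> complex"
  assumes H: "rkhs K H ip" and H': "rkhs K' H' ip'"
    and \<phi>: "\<And>x. \<phi> x \<in> H" and \<psi>: "\<And>x. \<psi> x \<in> H'"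
    and gram: "\<And>x y. ip (\<phi> x) (\<phi> y) = ip' (\<psi> x) (\<psi> y)"
    and u: "u \<in> H"
  obtains v where "v \<in> H'" "\<And>x. ip' v (\<psi> x) = ip u (\<phi> x)" "rkhs.nrm ip' v \<le> rkhs.nrm ip u"
proof -
  interpret H: rkhs K H ip by fact
  interpret H': rkhs K' H' ip' by fact
  have "H.nrm (comb \<phi> a) = H'.nrm (comb \<psi> a)" for a
    by (simp add: H.nrm_def H'.nrm_def H.ip_comb_comb[OF \<phi>] H'.ip_comb_comb[OF \<psi>] gram)
  then have "cmod (pairing (\<lambda>x. ip u (\<phi> x)) a) \<le> H.nrm u * H'.nrm (comb \<psi> a)" for a
    using H.cauchy_schwarz[OF u H.comb_mem[of \<phi> a, OF \<phi>]] by (simp add: H.ip_comb_right[OF u \<phi>])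
  from H'.riesz_features[OF \<psi> this] show ?thesis
    using that H.nrm_nonneg[OF u] by (metis max.absorb1)
qed

section \<open>Direct sums\<close>

text \<open>
  The Hilbert space sum of copies of \<open>H\<close> and one copy of the complex numbers, the latter sitting at \<open>None\<close>.
\<close>

definition component :: "(('i \<times> 'x) option \<Rightarrow> complex) \<Rightarrow> 'i \<Rightarrow> 'x \<Rightarrow> complex"
  where "component F i = (\<lambda>x. F (Some (i, x)))"

definition join :: "('i \<Rightarrow> 'x \<Rightarrow> complex) \<Rightarrow> complex \<Rightarrow> ('i \<times> 'x) option \<Rightarrow> complex"
  where "join f c = (\<lambda>p. case p of None \<Rightarrow> c | Some (i, x) \<Rightarrow> f i x)"

definition sum_space :: "('x \<Rightarrow> complex) set \<Rightarrow> (('i \<times> 'x) option \<Rightarrow> complex) set"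
  where "sum_space H = {F. \<forall>i. component F i \<in> H}"

definition sum_ip ::
  "(('x \<Rightarrow> complex) \<Rightarrow> ('x \<Rightarrow> complex) \<Rightarrow> complex) \<Rightarrow>
    (('i::finite \<times> 'x) option \<Rightarrow> complex) \<Rightarrow> (('i \<times> 'x) option \<Rightarrow> complex) \<Rightarrow> complex"
  where "sum_ip ip F G = (\<Sum>i\<in>UNIV. ip (component F i) (component G i)) + F None * cnj (G None)"

text \<open>The direct sum is encoded as a function space on the disjoint union of the copies of the
  domain and one extra point. It is thereby an instance of \<open>rkhs\<close>, and representation
  of functionals applies to it directly.\<close>

definition sum_kernel ::
  "('x \<Rightarrow> 'x \<Rightarrow> complex) \<Rightarrow> ('i \<times> 'x) option \<Rightarrow> ('i \<times> 'x) option \<Rightarrow> complex"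
  where "sum_kernel K p q = (case (p, q) of
      (None, None) \<Rightarrow> 1
    | (Some (i, x), Some (j, y)) \<Rightarrow> if i = j then K x y else 0
    | _ \<Rightarrow> 0)"

lemma component_simps [simp]:
  "component 0 i = 0"
  "component (F + G) i = component F i + component G i"
  "component (F - G) i = component F i - component G i"
  "component (\<lambda>p. c * F p) i = (\<lambda>x. c * component F i x)"
  "component (join f c) i = f i"
  "join f c None = c"
  by (auto simp: component_def join_def)

lemma join_component: "join (component F) (F None) = F"
  by (auto simp: component_def join_def fun_eq_iff split: option.splits)

lemma sum_kernel_section:
  "(\<lambda>p. sum_kernel K p (Some (j, y))) = join (\<lambda>i. if i = j then (\<lambda>x. K x y) else 0) 0"
  "(\<lambda>p. sum_kernel K p None) = join (\<lambda>i. 0) 1"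
  by (auto simp: sum_kernel_def join_def fun_eq_iff split: option.splits)

context rkhs
begin

lemma rkhs_sum: "rkhs (sum_kernel K) (sum_space H) (sum_ip ip :: (('i::finite \<times> 'x) option \<Rightarrow> complex) \<Rightarrow> _)"
proof
  fix f g h :: "('i \<times> 'x) option \<Rightarrow> complex"
  assume "f \<in> sum_space H" "g \<in> sum_space H" "h \<in> sum_space H"
  then show "sum_ip ip (f + g) h = sum_ip ip f h + sum_ip ip g h"
    by (simp add: sum_ip_def sum_space_def ip_add sum.distrib algebra_simps)
next
  fix c and f g :: "('i \<times> 'x) option \<Rightarrow> complex"
  assume "f \<in> sum_space H" "g \<in> sum_space H"
  then show "sum_ip ip (\<lambda>p. c * f p) g = c * sum_ip ip f g"
    by (simp add: sum_ip_def sum_space_def ip_scale sum_distrib_left algebra_simps)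
next
  fix f g :: "('i \<times> 'x) option \<Rightarrow> complex"
  assume "f \<in> sum_space H" "g \<in> sum_space H"
  then show "sum_ip ip g f = cnj (sum_ip ip f g)"
    by (simp add: sum_ip_def sum_space_def ip_commute[of "component f _"] mult.commute)
next
  fix f :: "('i \<times> 'x) option \<Rightarrow> complex"
  assume f: "f \<in> sum_space H"
  have *: "Re (sum_ip ip f f) = (\<Sum>i\<in>UNIV. Re (ip (component f i) (component f i))) + (cmod (f None))\<^sup>2"
    by (simp add: sum_ip_def complex_norm_square[symmetric] del: complex_mult_cnj)
  show "0 \<le> Re (sum_ip ip f f)"
    using f unfolding * by (auto simp: sum_space_def intro!: add_nonneg_nonneg sum_nonneg ip_nonneg)
  assume "sum_ip ip f f = 0"
  then have "(\<Sum>i\<in>UNIV. (nrm (component f i))\<^sup>2) + (cmod (f None))\<^sup>2 = 0"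
    using * f by (simp add: nrm_sq sum_space_def)
  then have "(\<Sum>i\<in>UNIV. (nrm (component f i))\<^sup>2) = 0" "f None = 0"
    by (auto simp: add_nonneg_eq_0_iff sum_nonneg)
  then have "component f i = 0" for i
    using f nrm_eq_0 by (auto simp: sum_nonneg_eq_0_iff sum_space_def)
  then show "f = 0"
    using join_component[of f] \<open>f None = 0\<close>
    by (auto simp: join_def fun_eq_iff component_def split: option.splits)
next
  fix s :: "nat \<Rightarrow> ('i \<times> 'x) option \<Rightarrow> complex"
  assume s: "\<And>n. s n \<in> sum_space H"
    and cauchy: "\<forall>e>0. \<exists>N. \<forall>m\<ge>N. \<forall>n\<ge>N. sqrt (Re (sum_ip ip (s m - s n) (s m - s n))) < e"
  have mem: "component (s n) i \<in> H" for n i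
    using s by (simp add: sum_space_def)
  have norm: "Re (sum_ip ip (f - g) (f - g))
      = (\<Sum>i\<in>UNIV. (nrm (component f i - component g i))\<^sup>2) + (cmod (f None - g None))\<^sup>2"
    if "f \<in> sum_space H" "g \<in> sum_space H" for f g :: "('i \<times> 'x) option \<Rightarrow> complex"
  proof -
    have "ip (component (f - g) i) (component (f - g) i)
        = of_real ((nrm (component f i - component g i))\<^sup>2)" for i
      using that ip_self[OF diff_mem] by (auto simp only: component_simps sum_space_def mem_Collect_eq)
    moreover have "(f - g) None = f None - g None"
      by simp
    ultimately show ?thesis
      unfolding sum_ip_def by (simp only: complex_norm_square[symmetric]) simp
  qed
  \<comment> \<open>Each component is dominated by the whole norm, so a Cauchy sequence is Cauchy in
    each component. As there are finitely many, the componentwise limits also give convergence in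
    the sum norm.\<close>
  have le1: "nrm (component f i - component g i) \<le> sqrt (Re (sum_ip ip (f - g) (f - g)))"
    if "f \<in> sum_space H" "g \<in> sum_space H" for f g :: "('i \<times> 'x) option \<Rightarrow> complex" and i
    unfolding norm[OF that]
  proof (intro real_le_rsqrt add_increasing2)
    show "(nrm (component f i - component g i))\<^sup>2
        \<le> (\<Sum>i\<in>UNIV. (nrm (component f i - component g i))\<^sup>2)"
      by (rule member_le_sum) auto
  qed simp
  have le2: "cmod (f None - g None) \<le> sqrt (Re (sum_ip ip (f - g) (f - g)))"
    if "f \<in> sum_space H" "g \<in> sum_space H" for f g :: "('i \<times> 'x) option \<Rightarrow> complex"
    unfolding norm[OF that] by (intro real_le_rsqrt) (simp add: sum_nonneg)
  have "\<exists>f\<in>H. (\<lambda>n. nrm (component (s n) i - f)) \<longlonglongrightarrow> 0" for i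
    unfolding nrm_def
  proof (rule complete)
    show "\<forall>e>0. \<exists>N. \<forall>m\<ge>N. \<forall>n\<ge>N. sqrt (Re (ip (component (s m) i - component (s n) i)
        (component (s m) i - component (s n) i))) < e"
      using cauchy le1[OF s s, where i = i] unfolding nrm_def by (meson le_less_trans)
  qed (rule mem)
  then obtain f where f: "\<And>i. f i \<in> H" "\<And>i. (\<lambda>n. nrm (component (s n) i - f i)) \<longlonglongrightarrow> 0"
    by metis
  have "Cauchy (\<lambda>n. s n None)"
    unfolding Cauchy_def dist_norm using cauchy le2[OF s s] by (meson le_less_trans)
  then obtain c where c: "(\<lambda>n. s n None) \<longlonglongrightarrow> c"
    using Cauchy_convergent_iff convergent_def by blast
  have F: "join f c \<in> sum_space H"
    using f by (simp add: sum_space_def)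
  have "(\<lambda>n. sqrt ((\<Sum>i\<in>UNIV. (nrm (component (s n) i - f i))\<^sup>2) + (cmod (s n None - c))\<^sup>2))
      \<longlonglongrightarrow> sqrt ((\<Sum>i\<in>(UNIV :: 'i set). 0\<^sup>2) + (cmod (c - c))\<^sup>2)"
    by (intro tendsto_intros f c)
  then have "(\<lambda>n. sqrt (Re (sum_ip ip (s n - join f c) (s n - join f c)))) \<longlonglongrightarrow> 0"
    by (simp add: norm[OF s F])
  then show "\<exists>f\<in>sum_space H. (\<lambda>n. sqrt (Re (sum_ip ip (s n - f) (s n - f)))) \<longlonglongrightarrow> 0"
    using F by blast
next
  fix w :: "('i \<times> 'x) option"
  have **: "ip 0 g = 0" "ip g 0 = 0" "ip g (\<lambda>_. 0) = 0" if "g \<in> H" for g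
    using that ip_zero ip_commute[OF zero_mem that] by (auto simp: zero_fun_def)
  show mem: "(\<lambda>z. sum_kernel K z w) \<in> sum_space H"
    by (cases w) (auto simp: sum_space_def sum_kernel_section kernel_mem
        zero_mem zero_mem[unfolded zero_fun_def])
  fix f :: "('i \<times> 'x) option \<Rightarrow> complex"
  assume f: "f \<in> sum_space H"
  show "sum_ip ip f (\<lambda>z. sum_kernel K z w) = f w"
  proof (cases w)
    case None
    then show ?thesis
      using f by (simp add: sum_ip_def sum_kernel_section sum_space_def **)
  next
    case (Some p)
    obtain j y where p: "p = (j, y)"
      by (cases p)
    have "ip (component f i) (if i = j then (\<lambda>x. K x y) else 0) = (if i = j then f w else 0)" for i
      using f reproducing[of "component f j" y]
      by (auto simp: sum_space_def ** Some p) (simp add: component_def)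
    then show ?thesis
      using Some p by (simp add: sum_ip_def sum_kernel_section)
  qed
qed (auto simp: sum_space_def zero_mem add_mem scale_mem)

lemma nrm_sum:
  assumes "F \<in> sum_space H"
  shows "(rkhs.nrm (sum_ip ip) F)\<^sup>2 = (\<Sum>i\<in>UNIV. (nrm (component F i))\<^sup>2) + (cmod (F None))\<^sup>2"
proof -
  interpret S: rkhs "sum_kernel K" "sum_space H" "sum_ip ip"
    by (rule rkhs_sum)
  show ?thesis
    using assms unfolding S.nrm_sq[OF assms]
    by (simp add: sum_ip_def sum_space_def nrm_sq complex_norm_square[symmetric]
        del: complex_mult_cnj)
qed

end

section \<open>Positive semidefinite kernels on the ball\<close>

text \<open>A factor g(z) g(w)^* is absorbed into the coefficients, so the new quadratic form is the
  old one at other coefficients.\<close>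

lemma gram_weight:
  "gram (\<lambda>z w. g z * K z w * cnj (g w)) a b
    = gram K (weight (\<lambda>x. cnj (g x)) a) (weight (\<lambda>x. cnj (g x)) b)"
proof -
  have "comb (section_at (\<lambda>z w. g z * K z w * cnj (g w))) a
      = (\<lambda>z. g z * comb (section_at K) (weight (\<lambda>x. cnj (g x)) a) z)"
  proof
    show "comb (section_at (\<lambda>z w. g z * K z w * cnj (g w))) a z
        = g z * comb (section_at K) (weight (\<lambda>x. cnj (g x)) a) z" for z
      unfolding comb_weight
      by (induction a) (auto simp: comb_Cons section_at_def algebra_simps)
  qed
  then show ?thesis
    by (simp add: gram_def pairing_weight)
qed

lemma gram_zero: "gram (\<lambda>z w. 0) a b = 0"
proof -
  have "comb (section_at (\<lambda>z w. 0)) a y = 0" for y :: 'a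
    by (induction a) (auto simp: comb_Cons section_at_def)
  then have "comb (section_at (\<lambda>z w. 0)) a = (\<lambda>_. 0)"
    by blast
  then show ?thesis
    by (simp add: gram_def)
qed

lemma gram_add: "gram (\<lambda>z w. K z w + L z w) a b = gram K a b + gram L a b"
proof -
  have "comb (section_at (\<lambda>z w. K z w + L z w)) a y
      = comb (section_at K) a y + comb (section_at L) a y" for y
    by (induction a) (auto simp: comb_Cons section_at_def algebra_simps)
  then have "comb (section_at (\<lambda>z w. K z w + L z w)) a = comb (section_at K) a + comb (section_at L) a"
    by (auto simp: fun_eq_iff)
  then show ?thesis
    by (simp only: gram_def pairing_add)
qed

lemma gram_diff: "gram (\<lambda>z w. K z w - L z w) a b = gram K a b - gram L a b"
  using gram_add[of "\<lambda>z w. K z w - L z w" L a b] by simp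

lemma gram_sum: "gram (\<lambda>z w. \<Sum>j\<in>A. K j z w) a b = (\<Sum>j\<in>A. gram (K j) a b)"
  by (induction A rule: infinite_finite_induct) (simp_all add: gram_zero gram_add)

lemma psd_kernel_one: "psd_kernel (\<lambda>z w. 1)"
proof
  fix a :: "(complex \<times> 'a) list"
  have *: "comb (section_at (\<lambda>z w. 1)) a y = cnj (pairing (\<lambda>_. 1) a)" for y :: 'a
    by (induction a) (auto simp: comb_Cons section_at_def)
  have "gram (\<lambda>z w. 1) a a = pairing (\<lambda>_. cnj (pairing (\<lambda>_. 1) a)) a"
    unfolding gram_def using * by (intro arg_cong[where f = "\<lambda>F. pairing F a"]) auto
  also have "\<dots> = of_real ((cmod (pairing (\<lambda>_. 1) a))\<^sup>2)"
    using pairing_cmult[of "cnj (pairing (\<lambda>_. 1) a)" "\<lambda>_. 1" a]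
    unfolding complex_norm_square by (simp add: mult.commute)
  finally have "gram (\<lambda>z w. 1) a a = of_real ((cmod (pairing (\<lambda>_. 1) a))\<^sup>2)" .
  then show "0 \<le> Re (gram (\<lambda>z w. 1) a a)"
    by simp
qed simp

lemma psd_kernel_weight:
  assumes "psd_kernel K"
  shows "psd_kernel (\<lambda>z w. g z * K z w * cnj (g w))"
proof
  interpret psd_kernel K by fact
  show "g w * K w z * cnj (g z) = cnj (g z * K z w * cnj (g w))" for w z
    by (simp add: kernel_cnj[of z w])
  show "0 \<le> Re (gram (\<lambda>z w. g z * K z w * cnj (g w)) a a)" for a
    by (simp add: gram_weight psd)
qed

lemma psd_kernel_sum:
  assumes "\<And>j. j \<in> A \<Longrightarrow> psd_kernel (K j)"
  shows "psd_kernel (\<lambda>z w. \<Sum>j\<in>A. K j z w)"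
proof
  show "(\<Sum>j\<in>A. K j w z) = cnj (\<Sum>j\<in>A. K j z w)" for w z
    unfolding cnj_sum by (intro sum.cong refl psd_kernel.kernel_cnj assms)
  show "0 \<le> Re (gram (\<lambda>z w. \<Sum>j\<in>A. K j z w) a a)" for a
    using assms psd_kernel.psd by (auto simp: gram_sum intro!: sum_nonneg)
qed

lemma psd_kernel_lim:
  assumes "\<And>n. psd_kernel (K n)" and lim: "\<And>z w. (\<lambda>n. K n z w) \<longlonglongrightarrow> L z w"
  shows "psd_kernel L"
proof
  fix z w
  have "(\<lambda>n. K n w z) \<longlonglongrightarrow> cnj (L z w)"
    using tendsto_cnj[OF lim[of z w]] by (simp add: psd_kernel.kernel_cnj[OF assms(1), of _ w z])
  then show "L w z = cnj (L z w)"
    using lim LIMSEQ_unique by blast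
next
  fix a
  have "(\<lambda>n. gram (K n) a a) \<longlonglongrightarrow> gram L a a"
    unfolding gram_def by (intro tendsto_pairing tendsto_comb) (simp add: section_at_def lim)
  then have "(\<lambda>n. Re (gram (K n) a a)) \<longlonglongrightarrow> Re (gram L a a)"
    by (rule tendsto_Re)
  then show "0 \<le> Re (gram L a a)"
    by (rule LIMSEQ_le_const) (auto simp: psd_kernel.psd[OF assms(1)])
qed

section \<open>Positivity of the Drury-Arveson kernel\<close>

lemma sum_cmod_sq_vec_of:
  fixes z :: "'n::finite unit_ball"
  shows "(\<Sum>j\<in>UNIV. (cmod (vec_of z $ j))\<^sup>2) < 1"
proof -
  have "norm (vec_of z) < 1"
    using vec_of[of z] by simp
  then show ?thesis
    by (simp add: norm_vec_def L2_set_def)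
qed

lemma cmod_herm_less_1:
  fixes z w :: "'n::finite unit_ball"
  shows "cmod (herm z w) < 1"
proof -
  have "cmod (herm z w) \<le> (\<Sum>j\<in>UNIV. \<bar>cmod (vec_of z $ j)\<bar> * \<bar>cmod (vec_of w $ j)\<bar>)"
    unfolding herm_def by (rule order_trans[OF norm_sum]) (simp add: norm_mult)
  also have "\<dots> \<le> norm (vec_of z) * norm (vec_of w)"
    unfolding norm_vec_def by (rule L2_set_mult_ineq)
  also have "\<dots> < 1 * 1"
    using vec_of[of z] vec_of[of w] by (intro mult_strict_mono') auto
  finally show ?thesis
    by simp
qed

lemma herm_neq_1: "herm z w \<noteq> 1"
  using cmod_herm_less_1[of z w] by auto

text \<open>Multiplying a kernel by z w^* produces a sum of weighted copies of it, one for each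
  coordinate, so no general Schur product theorem is called for.\<close>

lemma psd_kernel_herm_power: "psd_kernel (\<lambda>z w :: 'n::finite unit_ball. herm z w ^ n)"
proof (induction n)
  case 0
  show ?case
    using psd_kernel_one by simp
next
  case (Suc n)
  have "psd_kernel (\<lambda>z w :: 'n unit_ball. \<Sum>j\<in>UNIV. vec_of z $ j * herm z w ^ n * cnj (vec_of w $ j))"
    by (intro psd_kernel_sum psd_kernel_weight Suc)
  moreover have "herm z w * t = (\<Sum>j\<in>UNIV. vec_of z $ j * t * cnj (vec_of w $ j))"
    for t and z w :: "'n unit_ball"
    by (simp add: herm_def sum_distrib_left mult_ac)
  ultimately show ?case
    by simp
qed

text \<open>The geometric series in z w^* converges pointwise because |z w^*| < 1.\<close>

lemma psd_kernel_da: "psd_kernel (da_kernel :: 'n::finite unit_ball \<Rightarrow> _)"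
proof (rule psd_kernel_lim)
  show "psd_kernel (\<lambda>z w :: 'n unit_ball. \<Sum>k<n. herm z w ^ k)" for n
    by (intro psd_kernel_sum psd_kernel_herm_power)
  show "(\<lambda>n. \<Sum>k<n. herm z w ^ k) \<longlonglongrightarrow> da_kernel z w" for z w :: "'n unit_ball"
    using geometric_sums[OF cmod_herm_less_1[of z w]] by (simp add: sums_def da_kernel_def)
qed

interpretation DA: rkhs "da_kernel :: 'n::finite unit_ball \<Rightarrow> _" drury_arveson "snd (rkhs_of da_kernel)"
  by (rule rkhs_rkhs_of[OF psd_kernel_da])

section \<open>De Branges--Rovnyak spaces\<close>

lemma multiplier_mem: "b \<in> multiplier_unit_ball \<Longrightarrow> f \<in> drury_arveson \<Longrightarrow> b * f \<in> drury_arveson"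
  by (simp add: multiplier_unit_ball_def multipliers_def)

lemma multiplier_contractive:
  assumes b: "b \<in> multiplier_unit_ball" and f: "f \<in> drury_arveson"
  shows "DA.nrm (b * f) \<le> DA.nrm f"
proof (cases "DA.nrm f = 0")
  case True
  then have "f = 0"
    using f DA.nrm_eq_0 by blast
  then show ?thesis
    by simp
next
  case False
  then have pos: "0 < DA.nrm f"
    using DA.nrm_nonneg[OF f] by simp
  define g where "g = (\<lambda>x. of_real (1 / DA.nrm f) * f x)"
  have g: "g \<in> drury_arveson" "DA.nrm g = 1"
    using pos unfolding g_def DA.nrm_scale[OF f] by (simp_all only: DA.scale_mem[OF f]) (simp add: norm_divide)
  have "(SUP f \<in> {f \<in> drury_arveson. da_norm f \<le> 1}. ennreal (da_norm (b * f))) \<le> 1"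
    using b by (simp add: multiplier_unit_ball_def multiplier_norm_def)
  then have "ennreal (da_norm (b * g)) \<le> 1"
    using g by (auto simp: SUP_le_iff rkhs_norm_def DA.nrm_def)
  then have "DA.nrm (b * g) \<le> 1"
    by (simp add: rkhs_norm_def DA.nrm_def)
  moreover have "b * g = (\<lambda>x. of_real (1 / DA.nrm f) * (b * f) x)"
    by (simp add: g_def fun_eq_iff)
  ultimately have "cmod (of_real (1 / DA.nrm f)) * DA.nrm (b * f) \<le> 1"
    using DA.nrm_scale[OF multiplier_mem[OF b f]] by metis
  then show ?thesis
    using pos by (simp add: norm_divide field_simps)
qed

text \<open>
  The combination with weights \<open>cnj (b w)\<close> is the image of \<open>comb (section_at da_kernel) a\<close> under the
  adjoint of multiplication by \<open>b\<close>.
\<close>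

abbreviation adjoint_image ::
  "('n::finite unit_ball \<Rightarrow> complex) \<Rightarrow> (complex \<times> 'n unit_ball) list \<Rightarrow> 'n unit_ball \<Rightarrow> complex"
  where "adjoint_image b a \<equiv> comb (section_at da_kernel) (weight (\<lambda>w. cnj (b w)) a)"

lemma DA_comb_mem: "comb (section_at da_kernel) a \<in> drury_arveson"
  by (intro DA.comb_mem DA.kernel_section_mem)

lemma gram_da: "Re (gram da_kernel a a) = (DA.nrm (comb (section_at da_kernel) a))\<^sup>2"
  by (simp add: DA.nrm_sq DA_comb_mem DA.ip_comb_section gram_def)

lemma dbr_kernel_eq:
  "dbr_kernel b = (\<lambda>z w. da_kernel z w - b z * da_kernel z w * cnj (b w))"
  by (simp add: dbr_kernel_def da_kernel_def fun_eq_iff diff_divide_distrib)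

lemma gram_dbr:
  "Re (gram (dbr_kernel b) a a)
    = (DA.nrm (comb (section_at da_kernel) a))\<^sup>2 - (DA.nrm (adjoint_image b a))\<^sup>2"
  by (simp add: dbr_kernel_eq gram_diff gram_weight gram_da)

text \<open>In operator terms: \<open>M\<^sub>b (1 - M\<^sub>b\<^sup>* M\<^sub>b) M\<^sub>b\<^sup>* \<le> 1 - M\<^sub>b M\<^sub>b\<^sup>*\<close>, from \<open>(1 - M\<^sub>b M\<^sub>b\<^sup>*)\<^sup>2 \<ge> 0\<close>.\<close>

lemma defect_le_gram_dbr:
  assumes b: "b \<in> multiplier_unit_ball"
  shows "(DA.nrm (adjoint_image b a))\<^sup>2 - (DA.nrm (b * adjoint_image b a))\<^sup>2
    \<le> Re (gram (dbr_kernel b) a a)"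
proof -
  let ?x = "comb (section_at da_kernel) a" and ?G = "adjoint_image b a"
  have mem: "?x \<in> drury_arveson" "b * ?G \<in> drury_arveson"
    by (intro DA_comb_mem multiplier_mem b)+
  \<comment> \<open>The adjoint relation <b G, x> = <G, G>, obtained by moving the factor
    \<open>b\<close> from the values into the coefficients.\<close>
  have "snd (rkhs_of da_kernel) (b * ?G) ?x = pairing (\<lambda>w. b w * ?G w) a"
    unfolding DA.ip_comb_section[OF mem(2)] by (simp only: times_fun_def)
  also have "\<dots> = snd (rkhs_of da_kernel) ?G ?G"
    by (simp add: DA.ip_comb_section DA_comb_mem pairing_weight)
  finally have "snd (rkhs_of da_kernel) (b * ?G) ?x = snd (rkhs_of da_kernel) ?G ?G" .
  then have "(DA.nrm (b * ?G - ?x))\<^sup>2 = (DA.nrm (b * ?G))\<^sup>2 - 2 * (DA.nrm ?G)\<^sup>2 + (DA.nrm ?x)\<^sup>2"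
    using DA.nrm_diff_sq[OF mem(2,1)] by (simp only: DA.nrm_sq[OF DA_comb_mem])
  then show ?thesis
    unfolding gram_dbr using zero_le_power2[of "DA.nrm (b * ?G - ?x)"] by argo
qed

text \<open>The defect estimate bounds the quadratic form below by ||G||^2 - ||b G||^2, so
  contractivity of multiplication suffices and the norm of the adjoint need not be computed.\<close>

lemma psd_kernel_dbr:
  assumes b: "b \<in> multiplier_unit_ball"
  shows "psd_kernel (dbr_kernel b)"
proof
  show "dbr_kernel b w z = cnj (dbr_kernel b z w)" for w z
    by (simp add: dbr_kernel_def herm_def mult.commute)
  show "0 \<le> Re (gram (dbr_kernel b) a a)" for a
  proof -
    have "(DA.nrm (b * adjoint_image b a))\<^sup>2 \<le> (DA.nrm (adjoint_image b a))\<^sup>2"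
      by (intro power_mono multiplier_contractive b DA_comb_mem DA.nrm_nonneg multiplier_mem)
    then show ?thesis
      using defect_le_gram_dbr[OF b, of a] by argo
  qed
qed

lemma rkhs_dbr:
  "b \<in> multiplier_unit_ball \<Longrightarrow>
    rkhs (dbr_kernel b) (rkhs_space (dbr_kernel b)) (snd (rkhs_of (dbr_kernel b)))"
  by (rule rkhs_rkhs_of[OF psd_kernel_dbr])

text \<open>The pairing of b(z) k(z, l) with a combination is, up to conjugation, the value G(l) of
  its adjoint image. As f(l) is not 0, this value is controlled by ||f G||, hence by the defect of
  \<open>b\<close> at G, hence by the norm in H(b).\<close>

lemma mult_kernel_mem_dbr:
  assumes b: "b \<in> multiplier_unit_ball"
    and f: "\<And>G. G \<in> drury_arveson \<Longrightarrow> f * G \<in> drury_arveson"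
    and le: "\<And>G. G \<in> drury_arveson \<Longrightarrow>
      (DA.nrm (b * G))\<^sup>2 + \<delta> * (DA.nrm (f * G))\<^sup>2 \<le> (DA.nrm G)\<^sup>2"
    and \<delta>: "0 < \<delta>" and nz: "f l \<noteq> 0"
  shows "(\<lambda>z. b z * da_kernel z l) \<in> rkhs_space (dbr_kernel b)"
proof -
  interpret R: rkhs "dbr_kernel b" "rkhs_space (dbr_kernel b)" "snd (rkhs_of (dbr_kernel b))"
    by (rule rkhs_dbr[OF b])
  let ?h = "\<lambda>z. b z * da_kernel z l"
  let ?k = "section_at da_kernel l"
  \<comment> \<open>The numerator comes from evaluating f G at \<open>l\<close>, the factor |f(l)|
    from dividing \<open>f\<close> out, and the root of \<delta> from the hypothesis on the
    defect.\<close>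
  let ?C = "DA.nrm ?k / (cmod (f l) * sqrt \<delta>)"
  have "cmod (pairing ?h a) \<le> ?C * R.nrm (comb (section_at (dbr_kernel b)) a)" for a
  proof -
    let ?G = "adjoint_image b a"
    let ?N = "R.nrm (comb (section_at (dbr_kernel b)) a)"
    have mem: "comb (section_at (dbr_kernel b)) a \<in> rkhs_space (dbr_kernel b)"
      by (intro R.comb_mem R.kernel_section_mem)
    have N: "?N\<^sup>2 = Re (gram (dbr_kernel b) a a)" "0 \<le> ?N"
      using mem by (simp_all add: R.nrm_sq R.ip_comb_section gram_def R.nrm_nonneg)
    have "pairing ?h a = pairing ?k (weight (\<lambda>w. cnj (b w)) a)"
      by (simp add: pairing_weight section_at_def)
    also have "\<dots> = snd (rkhs_of da_kernel) ?k ?G"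
      by (simp add: DA.ip_comb_section DA.kernel_section_mem)
    also have "\<dots> = cnj (?G l)"
      using DA.ip_commute[OF DA_comb_mem DA.kernel_section_mem] DA.ip_kernel_section[OF DA_comb_mem]
      by metis
    finally have 1: "cmod (pairing ?h a) = cmod (?G l)"
      by simp
    have fG: "f * ?G \<in> drury_arveson"
      by (intro f DA_comb_mem)
    have "\<delta> * (DA.nrm (f * ?G))\<^sup>2 \<le> (DA.nrm ?G)\<^sup>2 - (DA.nrm (b * ?G))\<^sup>2"
      using le[OF DA_comb_mem] by (simp only: le_diff_eq add.commute)
    also have "\<dots> \<le> ?N\<^sup>2"
      unfolding N by (rule defect_le_gram_dbr[OF b])
    finally have "\<delta> * (DA.nrm (f * ?G))\<^sup>2 \<le> ?N\<^sup>2" .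
    then have "(sqrt \<delta> * DA.nrm (f * ?G))\<^sup>2 \<le> ?N\<^sup>2"
      using \<delta> by (simp add: power_mult_distrib)
    then have 2: "sqrt \<delta> * DA.nrm (f * ?G) \<le> ?N"
      using N(2) by (rule power2_le_imp_le)
    have "cmod (f l) * cmod (?G l) \<le> DA.nrm (f * ?G) * DA.nrm ?k"
      using DA.cmod_le_nrm[OF fG, of l] by (simp add: norm_mult)
    then have "sqrt \<delta> * (cmod (f l) * cmod (?G l)) \<le> sqrt \<delta> * (DA.nrm (f * ?G) * DA.nrm ?k)"
      using \<delta> by (intro mult_left_mono) auto
    also have "\<dots> \<le> ?N * DA.nrm ?k"
      using mult_right_mono[OF 2 DA.nrm_nonneg[OF DA.kernel_section_mem]] by (simp add: mult.assoc)
    finally have "cmod (?G l) * (cmod (f l) * sqrt \<delta>) \<le> DA.nrm ?k * ?N"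
      by (simp only: mult_ac)
    moreover have "0 < cmod (f l) * sqrt \<delta>"
      using \<delta> nz by simp
    ultimately have "cmod (?G l) \<le> DA.nrm ?k * ?N / (cmod (f l) * sqrt \<delta>)"
      by (simp only: pos_le_divide_eq)
    then show ?thesis
      unfolding 1 by (simp only: times_divide_eq_left)
  qed
  then obtain v where "v \<in> rkhs_space (dbr_kernel b)"
      "\<And>x. snd (rkhs_of (dbr_kernel b)) v (section_at (dbr_kernel b) x) = ?h x"
    by (rule R.riesz_features[OF R.kernel_section_mem]) blast
  moreover from this have "v = ?h"
    by (auto simp: R.ip_kernel_section)
  ultimately show ?thesis
    by simp
qed

text \<open>
  The next two lemmas compare the two decompositions \<open>k\<^sup>b(z, w) + b(z) b(w)\<^sup>*\<close> and
  \<open>z w\<^sup>* k\<^sup>b(z, w) + 1\<close> of one and the same kernel.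
\<close>

context
  fixes b :: "'n::finite unit_ball \<Rightarrow> complex"
  assumes b: "b \<in> multiplier_unit_ball"
begin

interpretation R: rkhs "dbr_kernel b" "rkhs_space (dbr_kernel b)" "snd (rkhs_of (dbr_kernel b))"
  by (rule rkhs_dbr[OF b])

text \<open>Chosen so that the inner product of (g, c) with it is the value g(w) + c b(w); the
  conjugate compensates for conjugate linearity in the second argument. \<open>shift_feature\<close>
  yields the values of the other kind of representation in the same way.\<close>

definition column_feature :: "'n unit_ball \<Rightarrow> (unit \<times> 'n unit_ball) option \<Rightarrow> complex"
  where "column_feature w = join (\<lambda>_. section_at (dbr_kernel b) w) (cnj (b w))"

definition shift_feature :: "'n unit_ball \<Rightarrow> ('n \<times> 'n unit_ball) option \<Rightarrow> complex"
  where "shift_feature w = join (\<lambda>j z. cnj (vec_of w $ j) * section_at (dbr_kernel b) w z) 1"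

lemma column_feature_mem: "column_feature w \<in> sum_space (rkhs_space (dbr_kernel b))"
  by (simp add: sum_space_def column_feature_def R.kernel_section_mem)

lemma shift_feature_mem: "shift_feature w \<in> sum_space (rkhs_space (dbr_kernel b))"
  by (simp add: sum_space_def shift_feature_def R.scale_mem R.kernel_section_mem)

lemma ip_column_feature:
  assumes "F \<in> sum_space (rkhs_space (dbr_kernel b))"
  shows "sum_ip (snd (rkhs_of (dbr_kernel b))) F (column_feature w) = component F () w + F None * b w"
  using assms by (simp add: sum_ip_def column_feature_def sum_space_def R.ip_kernel_section UNIV_unit)

lemma ip_shift_feature:
  assumes "F \<in> sum_space (rkhs_space (dbr_kernel b))"
  shows "sum_ip (snd (rkhs_of (dbr_kernel b))) F (shift_feature w)
    = (\<Sum>j\<in>UNIV. vec_of w $ j * component F j w) + F None"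
  using assms by (simp add: sum_ip_def shift_feature_def sum_space_def R.ip_kernel_section
      R.ip_scale_right R.kernel_section_mem)

lemma feature_gram:
  "sum_ip (snd (rkhs_of (dbr_kernel b))) (column_feature x) (column_feature y)
    = sum_ip (snd (rkhs_of (dbr_kernel b))) (shift_feature x) (shift_feature y)"
proof -
  have "sum_ip (snd (rkhs_of (dbr_kernel b))) (shift_feature x) (shift_feature y)
      = herm y x * dbr_kernel b y x + 1"
    unfolding ip_shift_feature[OF shift_feature_mem]
    by (simp add: shift_feature_def section_at_def herm_def sum_distrib_left mult_ac)
  also have "\<dots> = dbr_kernel b y x + cnj (b x) * b y"
    using herm_neq_1[of y x] by (simp add: dbr_kernel_def field_simps)
  also have "\<dots> = sum_ip (snd (rkhs_of (dbr_kernel b))) (column_feature x) (column_feature y)"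
    unfolding ip_column_feature[OF column_feature_mem]
    by (simp add: column_feature_def section_at_def)
  finally show ?thesis ..
qed

lemma column_to_shift:
  assumes g: "g \<in> rkhs_space (dbr_kernel b)"
  obtains gs \<gamma> where "\<And>j. gs j \<in> rkhs_space (dbr_kernel b)"
    "\<And>w. (\<Sum>j\<in>UNIV. vec_of w $ j * gs j w) + \<gamma> = g w + c * b w"
    "(\<Sum>j\<in>UNIV. (R.nrm (gs j))\<^sup>2) + (cmod \<gamma>)\<^sup>2 \<le> (R.nrm g)\<^sup>2 + (cmod c)\<^sup>2"
proof -
  interpret S1: rkhs "sum_kernel (dbr_kernel b)" "sum_space (rkhs_space (dbr_kernel b))"
    "sum_ip (snd (rkhs_of (dbr_kernel b))) :: ((unit \<times> 'n unit_ball) option \<Rightarrow> complex) \<Rightarrow> _"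
    by (rule R.rkhs_sum)
  interpret S2: rkhs "sum_kernel (dbr_kernel b)" "sum_space (rkhs_space (dbr_kernel b))"
    "sum_ip (snd (rkhs_of (dbr_kernel b))) :: (('n \<times> 'n unit_ball) option \<Rightarrow> complex) \<Rightarrow> _"
    by (rule R.rkhs_sum)
  let ?u = "join (\<lambda>_. g) c :: (unit \<times> 'n unit_ball) option \<Rightarrow> complex"
  have u: "?u \<in> sum_space (rkhs_space (dbr_kernel b))"
    using g by (simp add: sum_space_def)
  obtain v where v: "v \<in> sum_space (rkhs_space (dbr_kernel b))"
      "\<And>w. sum_ip (snd (rkhs_of (dbr_kernel b))) v (shift_feature w)
        = sum_ip (snd (rkhs_of (dbr_kernel b))) ?u (column_feature w)"
      "S2.nrm v \<le> S1.nrm ?u"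
    by (rule transfer_features[where \<phi> = column_feature and \<psi> = shift_feature and u = ?u,
          OF S1.rkhs_axioms S2.rkhs_axioms column_feature_mem shift_feature_mem feature_gram u]) blast
  have "(S2.nrm v)\<^sup>2 \<le> (S1.nrm ?u)\<^sup>2"
    using v S2.nrm_nonneg by (intro power_mono)
  then show ?thesis
    using v u by (intro that[of "component v" "v None"])
      (simp_all add: R.nrm_sum ip_shift_feature ip_column_feature, simp add: sum_space_def)
qed

lemma shift_to_column:
  assumes gs: "\<And>j. gs j \<in> rkhs_space (dbr_kernel b)"
  obtains g c where "g \<in> rkhs_space (dbr_kernel b)"
    "\<And>w. g w + c * b w = (\<Sum>j\<in>UNIV. vec_of w $ j * gs j w) + \<gamma>"
    "(R.nrm g)\<^sup>2 + (cmod c)\<^sup>2 \<le> (\<Sum>j\<in>UNIV. (R.nrm (gs j))\<^sup>2) + (cmod \<gamma>)\<^sup>2"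
proof -
  interpret S1: rkhs "sum_kernel (dbr_kernel b)" "sum_space (rkhs_space (dbr_kernel b))"
    "sum_ip (snd (rkhs_of (dbr_kernel b))) :: ((unit \<times> 'n unit_ball) option \<Rightarrow> complex) \<Rightarrow> _"
    by (rule R.rkhs_sum)
  interpret S2: rkhs "sum_kernel (dbr_kernel b)" "sum_space (rkhs_space (dbr_kernel b))"
    "sum_ip (snd (rkhs_of (dbr_kernel b))) :: (('n \<times> 'n unit_ball) option \<Rightarrow> complex) \<Rightarrow> _"
    by (rule R.rkhs_sum)
  let ?u = "join gs \<gamma> :: ('n \<times> 'n unit_ball) option \<Rightarrow> complex"
  have u: "?u \<in> sum_space (rkhs_space (dbr_kernel b))"
    using gs by (simp add: sum_space_def)
  obtain v where v: "v \<in> sum_space (rkhs_space (dbr_kernel b))"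
      "\<And>w. sum_ip (snd (rkhs_of (dbr_kernel b))) v (column_feature w)
        = sum_ip (snd (rkhs_of (dbr_kernel b))) ?u (shift_feature w)"
      "S1.nrm v \<le> S2.nrm ?u"
    by (rule transfer_features[where \<phi> = shift_feature and \<psi> = column_feature and u = ?u,
          OF S2.rkhs_axioms S1.rkhs_axioms shift_feature_mem column_feature_mem
          feature_gram[symmetric] u]) blast
  have "(S1.nrm v)\<^sup>2 \<le> (S2.nrm ?u)\<^sup>2"
    using v S1.nrm_nonneg by (intro power_mono)
  then show ?thesis
    using v u by (intro that[of "component v ()" "v None"])
      (simp_all add: R.nrm_sum ip_shift_feature ip_column_feature UNIV_unit, simp add: sum_space_def)
qed

section \<open>Membership of b in H(b) and its consequence\<close>

lemma mem_dbr_if_mult_kernel_mem: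
  assumes h: "(\<lambda>z. b z * da_kernel z l) \<in> rkhs_space (dbr_kernel b)"
  shows "b \<in> rkhs_space (dbr_kernel b)"
proof -
  define h where "h = (\<lambda>z. b z * da_kernel z l)"
  have h: "h \<in> rkhs_space (dbr_kernel b)"
    using assms by (simp add: h_def)
  obtain g c where g: "g \<in> rkhs_space (dbr_kernel b)"
    and eq: "\<And>w. g w + c * b w = (\<Sum>j\<in>UNIV. vec_of w $ j * (cnj (vec_of l $ j) * h w)) + 0"
    and le: "(R.nrm g)\<^sup>2 + (cmod c)\<^sup>2
      \<le> (\<Sum>j\<in>UNIV. (R.nrm (\<lambda>z. cnj (vec_of l $ j) * h z))\<^sup>2) + (cmod 0)\<^sup>2"
    using shift_to_column[of "\<lambda>j z. cnj (vec_of l $ j) * h z" 0] R.scale_mem[OF h] by blast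
  have eq': "g w + c * b w = h w - b w" for w
  proof -
    have "g w + c * b w = herm w l * h w"
      unfolding eq by (simp add: herm_def sum_distrib_right mult.assoc)
    also have "\<dots> = h w - b w"
      using herm_neq_1[of w l] by (simp add: h_def da_kernel_def field_simps)
    finally show ?thesis .
  qed
  have "(\<Sum>j\<in>UNIV. (R.nrm (\<lambda>z. cnj (vec_of l $ j) * h z))\<^sup>2)
      = (\<Sum>j\<in>UNIV. (cmod (vec_of l $ j))\<^sup>2) * (R.nrm h)\<^sup>2"
    by (simp add: R.nrm_scale[OF h] power_mult_distrib sum_distrib_right)
  also have "\<dots> \<le> 1 * (R.nrm h)\<^sup>2"
    using sum_cmod_sq_vec_of[of l] by (intro mult_right_mono) auto
  finally have le': "(R.nrm g)\<^sup>2 + (cmod c)\<^sup>2 \<le> (R.nrm h)\<^sup>2"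
    using le by simp
  have "c \<noteq> -1"
  proof
    assume "c = -1"
    then have "g = h"
      using eq' by (simp add: fun_eq_iff)
    then show False
      using le' \<open>c = -1\<close> by simp
  qed
  then have "1 + c \<noteq> 0"
    by (metis add_eq_0_iff)
  then have "b = (\<lambda>w. (1 / (1 + c)) * (h - g) w)"
    using eq' by (auto simp: fun_eq_iff field_simps)
  then show ?thesis
    using R.scale_mem[OF R.diff_mem[OF h g], of "1 / (1 + c)"] by simp
qed

lemma not_quasi_extreme_if_mem_dbr:
  assumes mem: "b \<in> rkhs_space (dbr_kernel b)"
  shows "\<not> quasi_extreme b"
proof
  assume qe: "quasi_extreme b"
  let ?B = "(R.nrm b)\<^sup>2"
  \<comment> \<open>The minimizer of the cost \<delta>^2 ||b||^2 + (1 - \<delta>)^2 of writing b =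
    \<delta> b + (1 - \<delta>) b; the minimum is 1 - \<delta>.\<close>
  define \<delta> where "\<delta> = 1 / (?B + 1)"
  have \<delta>: "0 < \<delta>" "\<delta> * (?B + 1) = 1"
    by (simp_all add: \<delta>_def add_nonneg_pos add_nonneg_eq_0_iff)
  obtain gs \<gamma> where gs: "\<And>j. gs j \<in> rkhs_space (dbr_kernel b)"
    and eq: "\<And>w. (\<Sum>j\<in>UNIV. vec_of w $ j * gs j w) + \<gamma> = of_real \<delta> * b w + of_real (1 - \<delta>) * b w"
    and le: "(\<Sum>j\<in>UNIV. (R.nrm (gs j))\<^sup>2) + (cmod \<gamma>)\<^sup>2
      \<le> (R.nrm (\<lambda>w. of_real \<delta> * b w))\<^sup>2 + (cmod (of_real (1 - \<delta>)))\<^sup>2"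
    using column_to_shift[OF R.scale_mem[OF mem, of "of_real \<delta>"], of "of_real (1 - \<delta>)"] by blast
  have eq': "(\<Sum>j\<in>UNIV. vec_of w $ j * gs j w) + \<gamma> = b w" for w
    unfolding eq by (simp add: algebra_simps)
  \<comment> \<open>At the origin the sum vanishes, which identifies the constant with b(0). Its
    share |b(0)|^2 of the cost can then be subtracted.\<close>
  have "vec_of (origin :: 'n unit_ball) = 0"
    by (simp add: origin_def pt_of_inverse)
  then have \<gamma>: "\<gamma> = b origin"
    using eq'[of origin] by simp
  have "(R.nrm (\<lambda>w. of_real \<delta> * b w))\<^sup>2 + (cmod (of_real (1 - \<delta>)))\<^sup>2
      = \<delta> * (\<delta> * (?B + 1)) + 1 - 2 * \<delta>"
    by (simp add: R.nrm_scale[OF mem] power_mult_distrib power2_eq_square algebra_simps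
        del: of_real_diff)
  also have "\<dots> < 1"
    using \<delta> by simp
  finally have less: "(\<Sum>j\<in>UNIV. (R.nrm (gs j))\<^sup>2) < 1 - (cmod (b origin))\<^sup>2"
    using le \<gamma> by simp
  then have "admissible b gs"
    using gs eq' \<gamma> by (auto simp: admissible_def rkhs_norm_def R.nrm_def algebra_simps)
  then show False
    using qe less by (auto simp: quasi_extreme_def rkhs_norm_def R.nrm_def)
qed

end

text \<open>Strict convexity of the Hilbert space norm in exact form: the parallelogram law with
  unequal weights.\<close>

lemma (in rkhs) nrm_convex_combination:
  assumes f: "f \<in> H" and g: "g \<in> H"
  shows "(nrm ((\<lambda>x. of_real (1 - u) * f x) + (\<lambda>x. of_real u * g x)))\<^sup>2 + u * (1 - u) * (nrm (f - g))\<^sup>2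
    = (1 - u) * (nrm f)\<^sup>2 + u * (nrm g)\<^sup>2"
proof -
  have "Re (ip (\<lambda>x. of_real (1 - u) * f x) (\<lambda>x. of_real u * g x)) = (1 - u) * u * Re (ip f g)"
    using assms by (simp add: ip_scale ip_scale_right scale_mem del: of_real_diff)
  then show ?thesis
    unfolding nrm_diff_sq[OF f g] nrm_add_sq[OF scale_mem[OF f] scale_mem[OF g]]
      nrm_scale[OF f] nrm_scale[OF g] norm_of_real power_mult_distrib power2_abs
    by (simp only:) (simp add: algebra_simps power2_eq_square)
qed

theorem corollary1p2:
  fixes b :: "'n::finite unit_ball \<Rightarrow> complex"
  assumes "b \<in> multiplier_unit_ball"
    and "quasi_extreme b"
  shows "b extreme_point_of multiplier_unit_ball"
  unfolding extreme_point_of_def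
proof (intro conjI ballI notI)
  fix a c :: "'n unit_ball \<Rightarrow> complex"
  assume a: "a \<in> multiplier_unit_ball" and c: "c \<in> multiplier_unit_ball"
    and "b \<in> open_segment a c"
  then obtain u where "a \<noteq> c" and u: "0 < u" "u < 1" and b: "b = (1 - u) *\<^sub>R a + u *\<^sub>R c"
    by (auto simp: in_segment)
  then obtain l where l: "(a - c) l \<noteq> 0"
    by (auto simp: fun_eq_iff)
  have eq: "(a - c) * G = a * G - c * G" for G
    by (simp add: fun_eq_iff algebra_simps)
  have "(\<lambda>z. b z * da_kernel z l) \<in> rkhs_space (dbr_kernel b)"
  \<comment> \<open>Since a G and c G are no longer than G, the convexity identity leaves room for
    the term u (1 - u) ||(a - c) G||^2, which dictates \<delta>.\<close>
  proof (rule mult_kernel_mem_dbr[where f = "a - c" and \<delta> = "u * (1 - u)"])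
    fix G :: "'n unit_ball \<Rightarrow> complex" assume G: "G \<in> drury_arveson"
    note mem = multiplier_mem[OF a G] multiplier_mem[OF c G]
    show "(a - c) * G \<in> drury_arveson"
      unfolding eq by (intro DA.diff_mem mem)
    have "b * G = (\<lambda>x. of_real (1 - u) * (a * G) x) + (\<lambda>x. of_real u * (c * G) x)"
      by (simp add: b fun_eq_iff scaleR_fun_def scaleR_conv_of_real algebra_simps)
    then have "(DA.nrm (b * G))\<^sup>2 + u * (1 - u) * (DA.nrm ((a - c) * G))\<^sup>2
        = (1 - u) * (DA.nrm (a * G))\<^sup>2 + u * (DA.nrm (c * G))\<^sup>2"
      unfolding eq using DA.nrm_convex_combination[OF mem] by metis
    also have "\<dots> \<le> (1 - u) * (DA.nrm G)\<^sup>2 + u * (DA.nrm G)\<^sup>2"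
      using u by (intro add_mono mult_left_mono power_mono multiplier_contractive a c G
          DA.nrm_nonneg mem) auto
    also have "\<dots> = (DA.nrm G)\<^sup>2"
      by (simp add: algebra_simps)
    finally show "(DA.nrm (b * G))\<^sup>2 + u * (1 - u) * (DA.nrm ((a - c) * G))\<^sup>2 \<le> (DA.nrm G)\<^sup>2" .
  qed (use assms u l in auto)
  then have "b \<in> rkhs_space (dbr_kernel b)"
    by (rule mem_dbr_if_mult_kernel_mem[OF assms(1)])
  then show False
    using not_quasi_extreme_if_mem_dbr[OF assms(1)] assms(2) by blast
qed (rule assms(1))

end
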